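(* Let $G=(V,E)$ be a DAG, $M\ge1$ the number of identical machines and $\rho>1$ an integer communication delay. The algorithm ScheduleGeneralGraph (described in the context), with $\gamma=1/\sqrt{\ln\rho}$, produces a schedule of length at most $O\!\left(\frac{\ln\rho}{\ln\ln\rho}\right)\cdot(\mathsf{OPT}+\rho)$.
   Context: Problem: each vertex of the DAG $G=(V,E)$ is a unit-time job; an edge $(u,v)$ means $v$ depends on $u$. There are $M$ identical machines, time is slotted, and duplication is allowed. A copy of $v$ may start on machine $\mu$ at time $t$ only if for every predecessor $u$ of $v$ some copy of $u$ completed on $\mu$ by time $t$ or on another machine by time $t-\rho$. The makespan is the completion time of the last job; $\mathsf{OPT}$ is the minimum makespan. Notation: for a subgraph $H$ and vertex $v$, $A_H(v)$ is the set of vertices of $H$ with a directed path to $v$ in $H$, together with $v$; $A_H(S)=\bigcup_{v\in S}A_H(v)$; $E_H(v)$, $E_H(S)$ are the edge sets of the subgraphs induced by $A_H(v)$, $A_H(S)$. Estimates $\hat a_H(v)$, $\hat e_H(v)$ are mergeable count-distinct sketch estimates of $|A_H(v)|$, $|E_H(v)|$ with relative error $1/3$. FindBatch$(H,\gamma)$: bucket vertices by $K_i=\{v:2^i\le\hat e_H(v)<2^{i+1}\}$ ($k=O(\log\rho)$ buckets; vertices with no ancestor edges in the smallest); $B\leftarrow\emptyset$; while some bucket nonempty: for $i=k$ down to $1$: $s=0$; while $s<N=\Theta(\log n)$ and $K_i\neq\emptyset$: sample $v$ uniformly from $K_i$, remove it; compute $A_H(v),E_H(v)$ exactly; if $|A_H(v)\setminus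 A_H(B)|>\gamma|A_H(v)|$ and $|E_H(v)\setminus E_H(B)|>\gamma|E_H(v)|$ add $v$ to $B$ and set $s=0$, else $s\leftarrow s+1$. Then prune: with $H'=H\setminus A_H(B)$ remove every remaining bucket vertex with $\hat a_{H'}(v)/\hat a_H(v)\le2\gamma$ or $\hat e_{H'}(v)/\hat e_H(v)\le2\gamma$. Return $B$. ScheduleSmallSubgraph$(H,\gamma)$: while $H$ nonempty: $B\leftarrow$FindBatch$(H,\gamma)$; list schedule the sets $A_H(v)$, $v\in B$, each as one job of length $|A_H(v)|$ run in topological order on one machine, assigning greedily to the least loaded machine; insert a delay of $\rho$ on all machines; remove $A_H(B)$ from $H$. ScheduleGeneralGraph$(G)$: repeatedly let $V_H$ be the set of vertices obtained by processing the current $G$ from its sources with a queue, adding a vertex $v$ if $\hat a_G(v)\le\frac43\rho$ and enqueuing successors all of whose predecessors were added; remove $V_H$ from $G$; then schedule the induced subgraphs $H$ in order with ScheduleSmallSubgraph.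
   Formalization: FindBatch's edge test and edge pruning are skipped for vertices with no ancestor edges (read literally, 0>γ·0 never holds and a one-vertex graph loops forever); O(·) is read as an absolute constant for all ρ≥ρ₀ (at ρ=2, γ>1 and ln ln ρ<0); the estimates are assumed accurate to 1/3. *)

theory Defs
  imports "HOL-Probability.Probability" "HOL-Library.While_Combinator" "HOL-Library.Landau_Symbols"
begin

definition dag :: "'v set \<Rightarrow> ('v \<times> 'v) set \<Rightarrow> bool" where
  "dag V E \<longleftrightarrow> finite V \<and> E \<subseteq> V \<times> V \<and> acyclic E"

text \<open>
  A schedule is a set of copies \<open>(v, \<mu>, t)\<close>: a copy of job \<open>v\<close> runs on machine \<open>\<mu> < M\<close> during
  the slot from \<open>t\<close> to \<open>t + 1\<close>. A job may have several copies.
\<close>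

type_synonym 'v schedule = "('v \<times> nat \<times> nat) set"

definition valid_schedule ::
  "'v set \<Rightarrow> ('v \<times> 'v) set \<Rightarrow> nat \<Rightarrow> nat \<Rightarrow> 'v schedule \<Rightarrow> bool" where
  "valid_schedule V E M \<rho> S \<longleftrightarrow>
     finite S \<and>
     (\<forall>(v, \<mu>, t) \<in> S. v \<in> V \<and> \<mu> < M) \<and>
     (\<forall>v \<in> V. \<exists>\<mu> t. (v, \<mu>, t) \<in> S) \<and>
     (\<forall>u v \<mu> t. (u, \<mu>, t) \<in> S \<and> (v, \<mu>, t) \<in> S \<longrightarrow> u = v) \<and>
     (\<forall>(v, \<mu>, t) \<in> S. \<forall>u. (u, v) \<in> E \<longrightarrow>
        (\<exists>t'. (u, \<mu>, t') \<in> S \<and> t' + 1 \<le> t) \<or>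
        (\<exists>\<mu>' t'. \<mu>' \<noteq> \<mu> \<and> (u, \<mu>', t') \<in> S \<and> t' + 1 + \<rho> \<le> t))"

definition makespan :: "'v schedule \<Rightarrow> nat" where
  "makespan S = Max (insert 0 ((\<lambda>(v, \<mu>, t). t + 1) ` S))"

definition OPT :: "'v set \<Rightarrow> ('v \<times> 'v) set \<Rightarrow> nat \<Rightarrow> nat \<Rightarrow> nat" where
  "OPT V E M \<rho> = (LEAST T. \<exists>S. valid_schedule V E M \<rho> S \<and> makespan S = T)"

text \<open>
  All subgraphs that occur are induced subgraphs of one graph with edge set \<open>E\<close>, so a subgraph
  \<open>H\<close> is given by its vertex set \<open>H\<close>. For \<open>v \<notin> H\<close> the set \<open>ancestors E H v\<close> is empty.
\<close>

definition induced_edges :: "('v \<times> 'v) set \<Rightarrow> 'v set \<Rightarrow> ('v \<times> 'v) set" where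
  "induced_edges E U = E \<inter> U \<times> U"

definition ancestors :: "('v \<times> 'v) set \<Rightarrow> 'v set \<Rightarrow> 'v \<Rightarrow> 'v set" where
  "ancestors E H v = {u \<in> H. (u, v) \<in> (induced_edges E H)\<^sup>*}"

definition ancestors_set :: "('v \<times> 'v) set \<Rightarrow> 'v set \<Rightarrow> 'v set \<Rightarrow> 'v set" where
  "ancestors_set E H B = (\<Union>v\<in>B. ancestors E H v)"

definition ancestor_edges :: "('v \<times> 'v) set \<Rightarrow> 'v set \<Rightarrow> 'v \<Rightarrow> ('v \<times> 'v) set" where
  "ancestor_edges E H v = induced_edges E (ancestors E H v)"

definition ancestor_edges_set :: "('v \<times> 'v) set \<Rightarrow> 'v set \<Rightarrow> 'v set \<Rightarrow> ('v \<times> 'v) set" where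
  "ancestor_edges_set E H B = induced_edges E (ancestors_set E H B)"

text \<open>
  \<open>a H v\<close> and \<open>e H v\<close> are the estimates of the numbers of ancestors and of ancestor edges of \<open>v\<close>
  in \<open>H\<close>. Nothing is assumed about them except the relative error \<open>1/3\<close>.
\<close>

definition estimates ::
  "'v set \<Rightarrow> ('v \<times> 'v) set \<Rightarrow> ('v set \<Rightarrow> 'v \<Rightarrow> real) \<Rightarrow> ('v set \<Rightarrow> 'v \<Rightarrow> real) \<Rightarrow> bool" where
  "estimates V E a e \<longleftrightarrow>
     (\<forall>H \<subseteq> V. \<forall>v \<in> V.
        \<bar>a H v - real (card (ancestors E H v))\<bar> \<le> 1/3 * real (card (ancestors E H v)) \<and>
        \<bar>e H v - real (card (ancestor_edges E H v))\<bar> \<le> 1/3 * real (card (ancestor_edges E H v)))"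

text \<open>
  The randomised parts of the algorithm are subprobability mass functions: \<open>spmf_of_set\<close> is
  uniform sampling, and missing mass is the probability of nontermination. Choices that the
  algorithm leaves open (orders of enumeration, ties between machines) are Hilbert choices.
\<close>

definition list_of_set :: "'v set \<Rightarrow> 'v list" where
  "list_of_set U = (SOME xs. distinct xs \<and> set xs = U)"

definition topological_list :: "('v \<times> 'v) set \<Rightarrow> 'v set \<Rightarrow> 'v list" where
  "topological_list E U = (SOME xs. distinct xs \<and> set xs = U \<and>
     (\<forall>i < length xs. \<forall>j < length xs. (xs ! i, xs ! j) \<in> E \<longrightarrow> i < j))"

text \<open>
  The tests on edges apply only to vertices that have ancestor edges. For a vertex without
  ancestor edges the strict comparison would read \<open>0 > 0\<close> and the quotient of estimates \<open>0/0\<close>;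
  isolated vertices could never enter a batch.
\<close>

definition enough_new ::
  "('v \<times> 'v) set \<Rightarrow> 'v set \<Rightarrow> real \<Rightarrow> 'v set \<Rightarrow> 'v \<Rightarrow> bool" where
  "enough_new E H \<gamma> B v \<longleftrightarrow>
     real (card (ancestors E H v - ancestors_set E H B)) > \<gamma> * real (card (ancestors E H v)) \<and>
     (ancestor_edges E H v \<noteq> {} \<longrightarrow>
      real (card (ancestor_edges E H v - ancestor_edges_set E H B))
        > \<gamma> * real (card (ancestor_edges E H v)))"

definition pruned ::
  "('v set \<Rightarrow> 'v \<Rightarrow> real) \<Rightarrow> ('v set \<Rightarrow> 'v \<Rightarrow> real) \<Rightarrow> 'v set \<Rightarrow> 'v set \<Rightarrow> real \<Rightarrow> 'v \<Rightarrow> bool" where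
  "pruned a e H H' \<gamma> v \<longleftrightarrow>
     a H' v / a H v \<le> 2 * \<gamma> \<or> (e H v \<noteq> 0 \<and> e H' v / e H v \<le> 2 * \<gamma>)"

text \<open>
  In the subgraphs passed to FindBatch every vertex has at most \<open>2\<rho>\<close> ancestors, hence at most
  \<open>4\<rho>\<^sup>2\<close> ancestor edges and an edge estimate below \<open>8\<rho>\<^sup>2\<close>. This number of buckets therefore covers
  all vertices.
\<close>

definition num_buckets :: "nat \<Rightarrow> nat" where
  "num_buckets \<rho> = 2 * nat \<lceil>log 2 (real \<rho>)\<rceil> + 2"

definition bucket :: "('v set \<Rightarrow> 'v \<Rightarrow> real) \<Rightarrow> 'v set \<Rightarrow> nat \<Rightarrow> 'v set" where
  "bucket e H i = {v \<in> H. (2 ^ i \<le> e H v \<or> i = 1) \<and> e H v < 2 ^ (i + 1)}"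

text \<open>
  The state is \<open>(K, B)\<close>, where \<open>K i\<close> is the current content of bucket \<open>i\<close>. The argument \<open>s\<close>
  counts the consecutive failures.
\<close>

partial_function (spmf) sample_bucket ::
  "('v \<times> 'v) set \<Rightarrow> 'v set \<Rightarrow> real \<Rightarrow> nat \<Rightarrow> nat \<Rightarrow> nat \<Rightarrow> (nat \<Rightarrow> 'v set) \<Rightarrow> 'v set \<Rightarrow>
   ((nat \<Rightarrow> 'v set) \<times> 'v set) spmf" where
  "sample_bucket E H \<gamma> N i s K B =
     (if s < N \<and> K i \<noteq> {} then
        bind_spmf (spmf_of_set (K i)) (\<lambda>v.
          if enough_new E H \<gamma> B v
          then sample_bucket E H \<gamma> N i 0 (K(i := K i - {v})) (insert v B)
          else sample_bucket E H \<gamma> N i (s + 1) (K(i := K i - {v})) B)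
      else return_spmf (K, B))"

primrec sample_buckets ::
  "('v \<times> 'v) set \<Rightarrow> 'v set \<Rightarrow> real \<Rightarrow> nat \<Rightarrow> nat \<Rightarrow> (nat \<Rightarrow> 'v set) \<Rightarrow> 'v set \<Rightarrow>
   ((nat \<Rightarrow> 'v set) \<times> 'v set) spmf" where
  "sample_buckets E H \<gamma> N 0 K B = return_spmf (K, B)"
| "sample_buckets E H \<gamma> N (Suc i) K B =
     bind_spmf (sample_bucket E H \<gamma> N (Suc i) 0 K B)
       (\<lambda>(K', B'). sample_buckets E H \<gamma> N i K' B')"

partial_function (spmf) batch_loop ::
  "('v \<times> 'v) set \<Rightarrow> ('v set \<Rightarrow> 'v \<Rightarrow> real) \<Rightarrow> ('v set \<Rightarrow> 'v \<Rightarrow> real) \<Rightarrow> nat \<Rightarrow> nat \<Rightarrow>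
   'v set \<Rightarrow> real \<Rightarrow> (nat \<Rightarrow> 'v set) \<Rightarrow> 'v set \<Rightarrow> 'v set spmf" where
  "batch_loop E a e k N H \<gamma> K B =
     (if \<exists>i \<in> {1..k}. K i \<noteq> {} then
        bind_spmf (sample_buckets E H \<gamma> N k K B) (\<lambda>(K', B').
          batch_loop E a e k N H \<gamma>
            (\<lambda>i. {v \<in> K' i. \<not> pruned a e H (H - ancestors_set E H B') \<gamma> v}) B')
      else return_spmf B)"

definition find_batch ::
  "('v \<times> 'v) set \<Rightarrow> ('v set \<Rightarrow> 'v \<Rightarrow> real) \<Rightarrow> ('v set \<Rightarrow> 'v \<Rightarrow> real) \<Rightarrow> nat \<Rightarrow> nat \<Rightarrow>
   'v set \<Rightarrow> real \<Rightarrow> 'v set spmf" where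
  "find_batch E a e \<rho> N H \<gamma> = batch_loop E a e (num_buckets \<rho>) N H \<gamma> (bucket e H) {}"

text \<open>
  \<open>list_schedule E M T As\<close> runs the sets in \<open>As\<close>, each as one job on one machine, on \<open>M\<close> machines
  that are all free from time \<open>T\<close> on. It returns the machine loads and the copies.
\<close>

definition list_schedule ::
  "('v \<times> 'v) set \<Rightarrow> nat \<Rightarrow> nat \<Rightarrow> 'v set list \<Rightarrow> (nat \<Rightarrow> nat) \<times> 'v schedule" where
  "list_schedule E M T As =
     foldl (\<lambda>(load, S) A.
        let \<mu> = arg_min_on load {..<M};
            xs = topological_list E A
        in (load(\<mu> := load \<mu> + length xs),
            S \<union> {(xs ! j, \<mu>, T + load \<mu> + j) | j. j < length xs}))
       (\<lambda>_. 0, {}) As"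

text \<open>
  The state is \<open>(H, T, S)\<close>: \<open>T\<close> is the current time and \<open>S\<close> the schedule produced so far. All
  machines wait until the last job of the batch is complete, and then for a further \<open>\<rho>\<close>.
\<close>

partial_function (spmf) schedule_small_subgraph ::
  "('v \<times> 'v) set \<Rightarrow> ('v set \<Rightarrow> 'v \<Rightarrow> real) \<Rightarrow> ('v set \<Rightarrow> 'v \<Rightarrow> real) \<Rightarrow> nat \<Rightarrow> nat \<Rightarrow> nat \<Rightarrow>
   real \<Rightarrow> 'v set \<Rightarrow> nat \<Rightarrow> 'v schedule \<Rightarrow> (nat \<times> 'v schedule) spmf" where
  "schedule_small_subgraph E a e M \<rho> N \<gamma> H T S =
     (if H \<noteq> {} then
        bind_spmf (find_batch E a e \<rho> N H \<gamma>) (\<lambda>B.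
          let (load, S') = list_schedule E M T (map (ancestors E H) (list_of_set B))
          in schedule_small_subgraph E a e M \<rho> N \<gamma> (H - ancestors_set E H B)
               (T + Max (load ` {..<M}) + \<rho>) (S \<union> S'))
      else return_spmf (T, S))"

definition predecessors :: "('v \<times> 'v) set \<Rightarrow> 'v set \<Rightarrow> 'v \<Rightarrow> 'v set" where
  "predecessors E G v = {u \<in> G. (u, v) \<in> E}"

text \<open>The state of the loop is the queue together with the set of vertices added so far.\<close>

definition small_subgraph ::
  "('v \<times> 'v) set \<Rightarrow> ('v set \<Rightarrow> 'v \<Rightarrow> real) \<Rightarrow> nat \<Rightarrow> 'v set \<Rightarrow> 'v set" where
  "small_subgraph E a \<rho> G =
     snd (while (\<lambda>(Q, U). Q \<noteq> [])
       (\<lambda>(Q, U).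
          let v = hd Q; U' = insert v U in
          if a G v \<le> 4/3 * real \<rho>
          then (tl Q @ list_of_set {w \<in> G. (v, w) \<in> E \<and> predecessors E G w \<subseteq> U'}, U')
          else (tl Q, U))
       (list_of_set {v \<in> G. predecessors E G v = {}}, {}))"

definition small_subgraphs ::
  "('v \<times> 'v) set \<Rightarrow> ('v set \<Rightarrow> 'v \<Rightarrow> real) \<Rightarrow> nat \<Rightarrow> 'v set \<Rightarrow> 'v set list" where
  "small_subgraphs E a \<rho> V =
     snd (while (\<lambda>(G, Hs). G \<noteq> {})
       (\<lambda>(G, Hs). let H = small_subgraph E a \<rho> G in (G - H, Hs @ [H]))
       (V, []))"

primrec schedule_subgraphs ::
  "('v \<times> 'v) set \<Rightarrow> ('v set \<Rightarrow> 'v \<Rightarrow> real) \<Rightarrow> ('v set \<Rightarrow> 'v \<Rightarrow> real) \<Rightarrow> nat \<Rightarrow> nat \<Rightarrow> nat \<Rightarrow>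
   real \<Rightarrow> 'v set list \<Rightarrow> nat \<Rightarrow> 'v schedule \<Rightarrow> 'v schedule spmf" where
  "schedule_subgraphs E a e M \<rho> N \<gamma> [] T S = return_spmf S"
| "schedule_subgraphs E a e M \<rho> N \<gamma> (H # Hs) T S =
     bind_spmf (schedule_small_subgraph E a e M \<rho> N \<gamma> H T S)
       (\<lambda>(T', S'). schedule_subgraphs E a e M \<rho> N \<gamma> Hs T' S')"

definition schedule_general_graph ::
  "'v set \<Rightarrow> ('v \<times> 'v) set \<Rightarrow> ('v set \<Rightarrow> 'v \<Rightarrow> real) \<Rightarrow> ('v set \<Rightarrow> 'v \<Rightarrow> real) \<Rightarrow>
   nat \<Rightarrow> nat \<Rightarrow> nat \<Rightarrow> real \<Rightarrow> 'v schedule spmf" where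
  "schedule_general_graph V E a e M \<rho> N \<gamma> =
     schedule_subgraphs E a e M \<rho> N \<gamma> (small_subgraphs E a \<rho> V) 0 {}"

end

(* Batches. Every vertex chosen by FindBatch brings a fraction gamma of new ancestors, so the list
   scheduling loads of all batches sum to at most |V| / (gamma M) <= OPT / gamma, up to an additive
   O(rho) per batch. Every vertex that survives a batch has lost all but a fraction 4 gamma of its
   ancestors or of its ancestor edges, and the product of these two numbers is at most 8 rho^3 at
   the start, so O(log rho / log (1 / gamma)) batches exhaust a small subgraph.

   Small subgraphs. A vertex left out of V_H has more than rho ancestors in the current graph G. If
   no vertex of G can start before time tau, such a vertex cannot start before tau + rho: otherwise
   all its ancestors in G would have to run on its own machine, in at most rho slots. So the number
   of small subgraphs is at most (OPT + rho) / rho. *)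

theory Submission
  imports Defs
begin

text \<open>Nothing is argued in expectation. A vertex leaves its bucket in one of three ways: it
  joins the batch, it fails the exact count, or the estimates prune it. Each of them leaves it
  \<open>settled\<close>, whatever the order of sampling. So all bounds hold for every outcome, and
  the specification of each randomised procedure pairs losslessness with a property of the whole
  support.

  The constants come from the relative error 1/3. A true quotient is at most (4/3)/(2/3) = 2 times
  the quotient of the estimates, which turns the pruning threshold 2\<gamma> into 4\<gamma>. The
  cutoff 4/3 \<rho> on estimates leaves at most 2\<rho> ancestors inside a small subgraph and
  guarantees more than \<rho> for a rejected vertex.

  The parameter \<gamma> is a negative power of ln \<rho>, so that ln (1/(4\<gamma>)) has the order
  of ln (ln \<rho>), while the loss factor 1/\<gamma> = sqrt (ln \<rho>) stays below a multiple of
  ln \<rho> / ln (ln \<rho>).\<close>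

section \<open>Ancestors\<close>

lemma ancestors_subset: "ancestors E H v \<subseteq> H"
  by (auto simp: ancestors_def)

lemma self_in_ancestors: "v \<in> H \<Longrightarrow> v \<in> ancestors E H v"
  by (simp add: ancestors_def)

lemma ancestors_mono: "H' \<subseteq> H \<Longrightarrow> ancestors E H' v \<subseteq> ancestors E H v"
proof -
  assume "H' \<subseteq> H"
  then have "(induced_edges E H')\<^sup>* \<subseteq> (induced_edges E H)\<^sup>*"
    by (intro rtrancl_mono) (auto simp: induced_edges_def)
  with \<open>H' \<subseteq> H\<close> show ?thesis by (auto simp: ancestors_def)
qed

text \<open>This convention makes removal count as progress: a vertex already removed has no
  ancestors in the rest. A path into \<open>v\<close> is either empty, and starts outside
  \<open>H\<close>, or ends with an edge whose head lies in \<open>H\<close>.\<close>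

lemma ancestors_outside:
  assumes "v \<notin> H" shows "ancestors E H v = {}"
proof -
  have False if "u \<in> H" "(u, v) \<in> (induced_edges E H)\<^sup>*" for u
    using that(2,1) assms by (cases rule: rtranclE) (auto simp: induced_edges_def)
  then show ?thesis by (auto simp: ancestors_def)
qed

lemma predecessor_in_ancestors:
  assumes "(u, w) \<in> E" "u \<in> H" "w \<in> ancestors E H v"
  shows "u \<in> ancestors E H v"
proof -
  have "(u, w) \<in> induced_edges E H" using assms by (auto simp: ancestors_def induced_edges_def)
  then show ?thesis using assms by (auto simp: ancestors_def intro: converse_rtrancl_into_rtrancl)
qed

lemma ancestors_trans:
  "u \<in> ancestors E H w \<Longrightarrow> w \<in> ancestors E H v \<Longrightarrow> u \<in> ancestors E H v"
  by (auto simp: ancestors_def)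

lemma ancestors_set_subset: "ancestors_set E H B \<subseteq> H"
  unfolding ancestors_set_def by (intro UN_least ancestors_subset)

lemma ancestors_set_mono: "B \<subseteq> B' \<Longrightarrow> ancestors_set E H B \<subseteq> ancestors_set E H B'"
  by (auto simp: ancestors_set_def)

lemma ancestors_set_insert:
  "ancestors_set E H (insert v B) = ancestors E H v \<union> ancestors_set E H B"
  by (auto simp: ancestors_set_def)

lemma ancestor_edges_mono: "H' \<subseteq> H \<Longrightarrow> ancestor_edges E H' v \<subseteq> ancestor_edges E H v"
  using ancestors_mono[of H' H E v] by (auto simp: ancestor_edges_def induced_edges_def)

lemma ancestors_remaining:
  "ancestors E (H - ancestors_set E H B) v \<subseteq> ancestors E H v - ancestors_set E H B"
  using ancestors_mono[of "H - ancestors_set E H B" H E v]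
    ancestors_subset[of E "H - ancestors_set E H B" v] by blast

lemma ancestor_edges_remaining:
  "ancestor_edges E (H - ancestors_set E H B) v \<subseteq> ancestor_edges E H v - ancestor_edges_set E H B"
  using ancestors_remaining[of E H B v]
  by (auto simp: ancestor_edges_def ancestor_edges_set_def induced_edges_def)

lemma finite_ancestors: "finite H \<Longrightarrow> finite (ancestors E H v)"
  using ancestors_subset by (rule finite_subset)

lemma finite_ancestors_set: "finite H \<Longrightarrow> finite (ancestors_set E H B)"
  using ancestors_set_subset by (rule finite_subset)

lemma ancestor_edges_subset: "ancestor_edges E H v \<subseteq> ancestors E H v \<times> ancestors E H v"
  by (auto simp: ancestor_edges_def induced_edges_def)

lemma finite_ancestor_edges: "finite H \<Longrightarrow> finite (ancestor_edges E H v)"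
  by (rule finite_subset[OF ancestor_edges_subset]) (simp add: finite_ancestors)

lemma card_ancestor_edges_le:
  assumes "finite H" shows "card (ancestor_edges E H v) \<le> (card (ancestors E H v))\<^sup>2"
  using card_mono[OF _ ancestor_edges_subset[of E H v]] assms
  by (simp add: finite_ancestors card_cartesian_product power2_eq_square)

text \<open>The last edge of a nonempty path into \<open>v\<close> joins two ancestors of
  \<open>v\<close>, so it would be an ancestor edge. This serves the last batch of a small subgraph,
  which meets only such vertices.\<close>

lemma ancestors_without_edges:
  assumes "ancestor_edges E H v = {}" "v \<in> H" shows "ancestors E H v = {v}"
proof (rule ccontr)
  assume "ancestors E H v \<noteq> {v}"
  then obtain u where u: "u \<in> ancestors E H v" "u \<noteq> v"
    using self_in_ancestors[OF assms(2)] by blast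
  then have "(u, v) \<in> (induced_edges E H)\<^sup>*" by (simp add: ancestors_def)
  with u(2) obtain w where w: "(w, v) \<in> induced_edges E H" by (auto elim: rtranclE)
  then have "w \<in> ancestors E H v" by (auto simp: ancestors_def induced_edges_def)
  with w self_in_ancestors[OF assms(2)] have "(w, v) \<in> ancestor_edges E H v"
    by (auto simp: ancestor_edges_def induced_edges_def)
  with assms(1) show False by simp
qed

section \<open>Batches\<close>

text \<open>What is known about a vertex that has left its bucket. The factor is 4\<gamma> because
  pruning sees only estimates. The guard in the second disjunct matters: for a vertex without
  ancestor edges the comparison would read \<open>0 \<le> 0\<close>, and its removal could not be
  inferred.\<close>

definition settled :: "('v \<times> 'v) set \<Rightarrow> 'v set \<Rightarrow> real \<Rightarrow> 'v set \<Rightarrow> 'v \<Rightarrow> bool" where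
  "settled E H \<gamma> B v \<longleftrightarrow>
     real (card (ancestors E (H - ancestors_set E H B) v)) \<le> 4 * \<gamma> * real (card (ancestors E H v)) \<or>
     (ancestor_edges E H v \<noteq> {} \<and>
      real (card (ancestor_edges E (H - ancestors_set E H B) v))
        \<le> 4 * \<gamma> * real (card (ancestor_edges E H v)))"

text \<open>The amortisation of list scheduling: the work of a batch, duplicates included, is
  charged to the vertices that it removes. Successive batches remove disjoint sets, so the charges
  add up to the size of the subgraph.\<close>

definition frugal :: "('v \<times> 'v) set \<Rightarrow> 'v set \<Rightarrow> real \<Rightarrow> 'v set \<Rightarrow> bool" where
  "frugal E H \<gamma> B \<longleftrightarrow> B \<subseteq> H \<and>
     \<gamma> * (\<Sum>b\<in>B. real (card (ancestors E H b))) \<le> real (card (ancestors_set E H B))"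

text \<open>Vertices are settled at different moments of the loop, against the batch of that moment.
  A larger batch leaves a smaller rest, so the property survives until the batch is
  returned.\<close>

lemma settled_mono:
  assumes "finite H" "B \<subseteq> B'" "settled E H \<gamma> B v" shows "settled E H \<gamma> B' v"
proof -
  have sub: "H - ancestors_set E H B' \<subseteq> H - ancestors_set E H B"
    using ancestors_set_mono[OF assms(2)] by blast
  have "card (ancestors E (H - ancestors_set E H B') v) \<le> card (ancestors E (H - ancestors_set E H B) v)"
    "card (ancestor_edges E (H - ancestors_set E H B') v)
      \<le> card (ancestor_edges E (H - ancestors_set E H B) v)"
    using assms(1) card_mono[OF finite_ancestors ancestors_mono[OF sub]]
      card_mono[OF finite_ancestor_edges ancestor_edges_mono[OF sub]] by blast+
  then have
    "real (card (ancestors E (H - ancestors_set E H B') v))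
      \<le> real (card (ancestors E (H - ancestors_set E H B) v))"
    "real (card (ancestor_edges E (H - ancestors_set E H B') v))
      \<le> real (card (ancestor_edges E (H - ancestors_set E H B) v))"
    by simp_all
  then show ?thesis using assms(3) unfolding settled_def by (elim disjE conjE) linarith+
qed

lemma settled_if_member:
  assumes "v \<in> B" "v \<in> H" "\<gamma> \<ge> 0" shows "settled E H \<gamma> B v"
proof -
  have "v \<in> ancestors_set E H B"
    using assms(1) self_in_ancestors[OF assms(2), of E] by (auto simp: ancestors_set_def)
  then show ?thesis using assms(3) by (simp add: settled_def ancestors_outside)
qed

text \<open>The rest avoids \<open>ancestors_set E H B\<close>, so its edges lie outside
  \<open>ancestor_edges_set E H B\<close>. The counts of the failed test therefore bound the counts
  in the rest, even with \<gamma> in place of 4\<gamma>.\<close>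

lemma settled_if_not_enough_new:
  assumes "\<not> enough_new E H \<gamma> B v" "finite H" "\<gamma> \<ge> 0" shows "settled E H \<gamma> B v"
proof -
  have A: "card (ancestors E (H - ancestors_set E H B) v) \<le> card (ancestors E H v - ancestors_set E H B)"
    using assms by (intro card_mono ancestors_remaining) (simp add: finite_ancestors)
  have e: "card (ancestor_edges E (H - ancestors_set E H B) v)
      \<le> card (ancestor_edges E H v - ancestor_edges_set E H B)"
    using assms by (intro card_mono ancestor_edges_remaining) (simp add: finite_ancestor_edges)
  have g: "\<gamma> * real n \<le> 4 * \<gamma> * real n" for n using assms(3) by (simp add: mult_right_mono)
  show ?thesis using assms(1) A e g unfolding settled_def enough_new_def
    by (smt (verit) of_nat_le_iff)
qed

lemma settled_if_pruned:
  assumes "pruned a e H (H - ancestors_set E H B) \<gamma> v" "estimates V E a e" "finite V" "H \<subseteq> V" "v \<in> H"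
    and "\<gamma> \<ge> 0"
  shows "settled E H \<gamma> B v"
proof -
  let ?H' = "H - ancestors_set E H B"
  have fin: "finite H" using assms by (auto intro: finite_subset)
  have "?H' \<subseteq> V" "v \<in> V" using assms by auto
  with assms have est:
    "\<bar>a H v - card (ancestors E H v)\<bar> \<le> 1/3 * card (ancestors E H v)"
    "\<bar>e H v - card (ancestor_edges E H v)\<bar> \<le> 1/3 * card (ancestor_edges E H v)"
    "\<bar>a ?H' v - card (ancestors E ?H' v)\<bar> \<le> 1/3 * card (ancestors E ?H' v)"
    "\<bar>e ?H' v - card (ancestor_edges E ?H' v)\<bar> \<le> 1/3 * card (ancestor_edges E ?H' v)"
    unfolding estimates_def by blast+
  \<comment> \<open>The relative error gives \<open>y \<le> 3/2 * q\<close> and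
    \<open>p \<le> 4/3 * x\<close>, hence
    \<open>y \<le> 3/2 * (2 * \<gamma>) * (4/3 * x)\<close>.\<close>
  have ratio: "y \<le> 4 * \<gamma> * x"
    if "\<bar>p - x\<bar> \<le> 1/3 * x" "\<bar>q - y\<bar> \<le> 1/3 * y" "q / p \<le> 2 * \<gamma>" "x > 0" for p q x y :: real
  proof -
    have "p > 0" using that by linarith
    then have "q \<le> 2 * \<gamma> * p" using that by (simp add: divide_le_eq)
    also have "\<dots> \<le> 2 * \<gamma> * (4/3 * x)" using that assms(6) by (intro mult_left_mono) linarith+
    finally show ?thesis using that by linarith
  qed
  have "card (ancestors E H v) > 0"
    using self_in_ancestors[OF assms(5)] finite_ancestors[OF fin] by (auto simp: card_gt_0_iff)
  \<comment> \<open>The estimate of a zero count is zero, so the guard on \<open>e H v\<close> in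
    \<open>pruned\<close> yields the guard on edges in \<open>settled\<close>.\<close>
  moreover have "card (ancestor_edges E H v) > 0" if "e H v \<noteq> 0"
    using that est(2) by (cases "card (ancestor_edges E H v) = 0") auto
  moreover have "ancestor_edges E H v \<noteq> {}" if "e H v \<noteq> 0"
    using calculation(2)[OF that] by force
  ultimately show ?thesis
    using assms(1) ratio[OF est(1,3)] ratio[OF est(2,4)] unfolding pruned_def settled_def
    by (elim disjE conjE) simp_all
qed

text \<open>The set of covered ancestors grows by exactly the vertices that
  \<open>enough_new\<close> counts, and these make up more than a fraction \<gamma> of the new
  job.\<close>

lemma frugal_insert:
  assumes "finite H" "v \<in> H" "frugal E H \<gamma> B" "enough_new E H \<gamma> B v"
  shows "frugal E H \<gamma> (insert v B)"
proof (cases "v \<in> B")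
  case False
  have fB: "finite B" using assms by (auto simp: frugal_def intro: finite_subset)
  have "card (ancestors_set E H (insert v B))
      = card (ancestors E H v - ancestors_set E H B) + card (ancestors_set E H B)"
    using assms(1) card_Un_disjoint[of "ancestors E H v - ancestors_set E H B" "ancestors_set E H B"]
    by (simp add: ancestors_set_insert finite_ancestors finite_ancestors_set Diff_disjoint
        Int_commute)
  then show ?thesis using assms False fB unfolding frugal_def enough_new_def
    by (simp add: algebra_simps)
qed (use assms in \<open>simp add: insert_absorb\<close>)

section \<open>Invariants of the randomised loops on their whole support\<close>

text \<open>The rule for sequential composition in the sense of total correctness: losslessness is
  termination with probability one, and the postcondition holds for every outcome.\<close>

lemma bind_spmf_spec:
  assumes "lossless_spmf p"
    and "\<And>x. x \<in> set_spmf p \<Longrightarrow> lossless_spmf (f x) \<and> (\<forall>y \<in> set_spmf (f x). Q y)"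
  shows "lossless_spmf (bind_spmf p f) \<and> (\<forall>y \<in> set_spmf (bind_spmf p f). Q y)"
  using assms by (auto simp: set_bind_spmf)

text \<open>A preorder on loop states, so that it composes along the nested loops. Frugality enters
  as an implication because the inner loops start from an arbitrary batch.\<close>

definition advances ::
  "('v \<times> 'v) set \<Rightarrow> 'v set \<Rightarrow> real \<Rightarrow> (nat \<Rightarrow> 'v set) \<Rightarrow> 'v set \<Rightarrow> (nat \<Rightarrow> 'v set) \<Rightarrow> 'v set \<Rightarrow> bool" where
  "advances E H \<gamma> K B K' B' \<longleftrightarrow>
     (\<forall>i. K' i \<subseteq> K i) \<and> B \<subseteq> B' \<and> (frugal E H \<gamma> B \<longrightarrow> frugal E H \<gamma> B') \<and>
     (\<forall>i. \<forall>v \<in> K i - K' i. settled E H \<gamma> B' v)"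

lemma advances_refl: "advances E H \<gamma> K B K B"
  by (simp add: advances_def)

lemma advances_trans:
  assumes "finite H" "advances E H \<gamma> K B K' B'" "advances E H \<gamma> K' B' K'' B''"
  shows "advances E H \<gamma> K B K'' B''"
  unfolding advances_def
proof (intro conjI allI ballI impI)
  fix i v assume "v \<in> K i - K'' i"
  then show "settled E H \<gamma> B'' v"
    using assms settled_mono[OF assms(1), of B' B''] unfolding advances_def by blast
qed (use assms in \<open>unfold advances_def, blast+\<close>)

text \<open>Every success resets the counter \<open>s\<close>, so termination is measured by the
  bucket, which loses the sampled vertex in either branch. The strict inclusion at the end is what
  makes the outer loop terminate.\<close>

lemma sample_bucket_spec:
  assumes "finite H" "\<gamma> \<ge> 0" "K i \<subseteq> H"
  shows "lossless_spmf (sample_bucket E H \<gamma> N i s K B) \<and>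
    (\<forall>(K', B') \<in> set_spmf (sample_bucket E H \<gamma> N i s K B).
       advances E H \<gamma> K B K' B' \<and> (\<forall>j. j \<noteq> i \<longrightarrow> K' j = K j) \<and>
       (s < N \<and> K i \<noteq> {} \<longrightarrow> K' i \<subset> K i))"
  using assms(3)
proof (induction "card (K i)" arbitrary: s K B rule: less_induct)
  case less
  show ?case
  proof (cases "s < N \<and> K i \<noteq> {}")
    case False
    then show ?thesis
      by (subst (1 2) sample_bucket.simps) (auto simp: advances_refl)
  next
    case True
    have fin: "finite (K i)" using less.prems assms(1) by (rule finite_subset)
    define f where "f v = (if enough_new E H \<gamma> B v
          then sample_bucket E H \<gamma> N i 0 (K(i := K i - {v})) (insert v B)
          else sample_bucket E H \<gamma> N i (s + 1) (K(i := K i - {v})) B)" for v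
    have eq: "sample_bucket E H \<gamma> N i s K B = bind_spmf (spmf_of_set (K i)) f"
      using True by (subst sample_bucket.simps) (simp add: f_def[abs_def])
    have step: "lossless_spmf (f v) \<and> (\<forall>(K', B') \<in> set_spmf (f v).
       advances E H \<gamma> K B K' B' \<and> (\<forall>j. j \<noteq> i \<longrightarrow> K' j = K j) \<and>
       (s < N \<and> K i \<noteq> {} \<longrightarrow> K' i \<subset> K i))"
      if v: "v \<in> K i" for v
    proof -
      let ?K = "K(i := K i - {v})"
      define B1 where "B1 = (if enough_new E H \<gamma> B v then insert v B else B)"
      define s1 where "s1 = (if enough_new E H \<gamma> B v then 0 else s + 1)"
      have f: "f v = sample_bucket E H \<gamma> N i s1 ?K B1"
        by (simp add: f_def B1_def s1_def)
      have "v \<in> H" using v less.prems by auto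
      have "settled E H \<gamma> B1 v"
        using settled_if_member[of v B1 H \<gamma> E] settled_if_not_enough_new[of E H \<gamma> B v] assms \<open>v \<in> H\<close>
        by (auto simp: B1_def)
      then have 1: "advances E H \<gamma> K B ?K B1"
        using frugal_insert[OF assms(1) \<open>v \<in> H\<close>] by (auto simp: advances_def B1_def)
      have "card (?K i) < card (K i)" using card_Diff1_less[OF fin v] by (simp only: fun_upd_same)
      moreover have "?K i \<subseteq> H" using less.prems by auto
      ultimately have IH: "lossless_spmf (f v) \<and> (\<forall>(K', B') \<in> set_spmf (f v).
          advances E H \<gamma> ?K B1 K' B' \<and> (\<forall>j. j \<noteq> i \<longrightarrow> K' j = ?K j) \<and>
          (s1 < N \<and> ?K i \<noteq> {} \<longrightarrow> K' i \<subset> ?K i))"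
        unfolding f by (rule less.hyps)
      have res: "advances E H \<gamma> K B K' B' \<and> (\<forall>j. j \<noteq> i \<longrightarrow> K' j = K j) \<and>
       (s < N \<and> K i \<noteq> {} \<longrightarrow> K' i \<subset> K i)"
        if "(K', B') \<in> set_spmf (f v)" for K' B'
      proof -
        from IH that have 2: "advances E H \<gamma> ?K B1 K' B'" and 3: "\<forall>j. j \<noteq> i \<longrightarrow> K' j = ?K j"
          by auto
        from 2 have "K' i \<subseteq> ?K i" unfolding advances_def by blast
        then have "K' i \<subset> K i" using v by auto
        moreover have "\<forall>j. j \<noteq> i \<longrightarrow> K' j = K j" using 3 by simp
        ultimately show ?thesis using advances_trans[OF assms(1) 1 2] by blast
      qed
      have "\<forall>(K', B') \<in> set_spmf (f v).
          advances E H \<gamma> K B K' B' \<and> (\<forall>j. j \<noteq> i \<longrightarrow> K' j = K j) \<and>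
       (s < N \<and> K i \<noteq> {} \<longrightarrow> K' i \<subset> K i)"
        by (intro ballI case_prodI2 res) (simp only:)
      with IH[THEN conjunct1] show ?thesis by (rule conjI)
    qed
    have "lossless_spmf (spmf_of_set (K i))" using fin True by simp
    then show ?thesis unfolding eq
    proof (rule bind_spmf_spec)
      fix v assume "v \<in> set_spmf (spmf_of_set (K i))"
      then have "v \<in> K i" using fin by simp
      then show "lossless_spmf (f v) \<and> (\<forall>(K', B') \<in> set_spmf (f v).
         advances E H \<gamma> K B K' B' \<and> (\<forall>j. j \<noteq> i \<longrightarrow> K' j = K j) \<and>
         (s < N \<and> K i \<noteq> {} \<longrightarrow> K' i \<subset> K i))" by (rule step)
    qed
  qed
qed

text \<open>With \<open>N \<ge> 1\<close> every nonempty bucket is sampled at least once per round,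
  and only its own stage touches it. So a round that finds a nonempty bucket strictly shrinks
  one.\<close>

lemma sample_buckets_spec:
  assumes "finite H" "\<gamma> \<ge> 0" "\<forall>i. K i \<subseteq> H" "N \<ge> 1"
  shows "lossless_spmf (sample_buckets E H \<gamma> N m K B) \<and>
    (\<forall>(K', B') \<in> set_spmf (sample_buckets E H \<gamma> N m K B).
       advances E H \<gamma> K B K' B' \<and>
       ((\<exists>i\<in>{1..m}. K i \<noteq> {}) \<longrightarrow> (\<exists>i\<in>{1..m}. K' i \<subset> K i)))"
  using assms(3)
proof (induction m arbitrary: K B)
  case 0
  then show ?case by (simp add: advances_refl)
next
  case (Suc m)
  let ?p = "sample_bucket E H \<gamma> N (Suc m) 0 K B"
  have p: "lossless_spmf ?p"
    and p': "(K1, B1) \<in> set_spmf ?p \<Longrightarrow> advances E H \<gamma> K B K1 B1 \<and> (\<forall>j. j \<noteq> Suc m \<longrightarrow> K1 j = K j) \<and>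
       (K (Suc m) \<noteq> {} \<longrightarrow> K1 (Suc m) \<subset> K (Suc m))" for K1 B1
    using sample_bucket_spec[OF assms(1,2), of K "Suc m" E N 0 B] Suc.prems assms(4) by auto
  have q: "lossless_spmf (sample_buckets E H \<gamma> N m K1 B1) \<and>
     (\<forall>(K', B') \<in> set_spmf (sample_buckets E H \<gamma> N m K1 B1).
       advances E H \<gamma> K B K' B' \<and>
       ((\<exists>i\<in>{1..Suc m}. K i \<noteq> {}) \<longrightarrow> (\<exists>i\<in>{1..Suc m}. K' i \<subset> K i)))"
    if K1: "(K1, B1) \<in> set_spmf ?p" for K1 B1
  proof -
    note p1 = p'[OF K1]
    then have sub: "K1 i \<subseteq> K i" for i by (auto simp: advances_def)
    then have "\<forall>i. K1 i \<subseteq> H" using Suc.prems by blast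
    note IH = Suc.IH[OF this, of B1]
    have "advances E H \<gamma> K B K' B' \<and>
       ((\<exists>i\<in>{1..Suc m}. K i \<noteq> {}) \<longrightarrow> (\<exists>i\<in>{1..Suc m}. K' i \<subset> K i))"
      if K': "(K', B') \<in> set_spmf (sample_buckets E H \<gamma> N m K1 B1)" for K' B'
    proof (intro conjI impI)
      from IH K' have adv: "advances E H \<gamma> K1 B1 K' B'"
        and dec: "(\<exists>i\<in>{1..m}. K1 i \<noteq> {}) \<longrightarrow> (\<exists>i\<in>{1..m}. K' i \<subset> K1 i)" by auto
      show "advances E H \<gamma> K B K' B'" using advances_trans[OF assms(1)] p1 adv by blast
      from adv have sub': "K' i \<subseteq> K1 i" for i by (auto simp: advances_def)
      assume "\<exists>i\<in>{1..Suc m}. K i \<noteq> {}"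
      then obtain i where i: "1 \<le> i" "i \<le> Suc m" "K i \<noteq> {}" by (meson atLeastAtMost_iff)
      show "\<exists>i\<in>{1..Suc m}. K' i \<subset> K i"
      proof (cases "i = Suc m")
        case True
        then have "K' (Suc m) \<subset> K (Suc m)" using p1 i sub'[of "Suc m"] by blast
        then show ?thesis by force
      next
        case False
        then have "i \<in> {1..m}" "K1 i \<noteq> {}" using p1 i by auto
        then obtain j where "j \<in> {1..m}" "K' j \<subset> K1 j" using dec by blast
        then show ?thesis using sub[of j] by (intro bexI[of _ j]) auto
      qed
    qed
    with IH show ?thesis by blast
  qed
  show ?case unfolding sample_buckets.simps
    by (rule bind_spmf_spec[OF p]) (use q in fastforce)
qed

text \<open>The total size of the buckets decreases in every round, since pruning never refills what
  sampling has removed. A vertex that disappears in a round was sampled or pruned, and both settle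
  it.\<close>

lemma batch_loop_spec:
  assumes "finite V" "H \<subseteq> V" "estimates V E a e" "\<gamma> \<ge> 0" "\<forall>i. K i \<subseteq> H" "N \<ge> 1"
  shows "lossless_spmf (batch_loop E a e k N H \<gamma> K B) \<and>
    (\<forall>B' \<in> set_spmf (batch_loop E a e k N H \<gamma> K B).
       B \<subseteq> B' \<and> (frugal E H \<gamma> B \<longrightarrow> frugal E H \<gamma> B') \<and> (\<forall>i\<in>{1..k}. \<forall>v \<in> K i. settled E H \<gamma> B' v))"
  using assms(5)
proof (induction "\<Sum>i\<in>{1..k}. card (K i)" arbitrary: K B rule: less_induct)
  case less
  have fH: "finite H" using assms by (auto intro: finite_subset)
  show ?case
  proof (cases "\<exists>i \<in> {1..k}. K i \<noteq> {}")
    case False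
    then show ?thesis
      by (subst (1 2) batch_loop.simps) simp
  next
    case True
    let ?p = "sample_buckets E H \<gamma> N k K B"
    define K2 where "K2 K1 B1 = (\<lambda>i. {v \<in> K1 i. \<not> pruned a e H (H - ancestors_set E H B1) \<gamma> v})"
      for K1 :: "nat \<Rightarrow> 'a set" and B1
    have eq: "batch_loop E a e k N H \<gamma> K B =
        bind_spmf ?p (\<lambda>(K1, B1). batch_loop E a e k N H \<gamma> (K2 K1 B1) B1)"
      using True by (subst batch_loop.simps) (simp add: K2_def)
    note p = sample_buckets_spec[OF fH assms(4) less.prems assms(6), of E k B]
    have q: "lossless_spmf (batch_loop E a e k N H \<gamma> (K2 K1 B1) B1) \<and>
      (\<forall>B' \<in> set_spmf (batch_loop E a e k N H \<gamma> (K2 K1 B1) B1).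
       B \<subseteq> B' \<and> (frugal E H \<gamma> B \<longrightarrow> frugal E H \<gamma> B') \<and> (\<forall>i\<in>{1..k}. \<forall>v \<in> K i. settled E H \<gamma> B' v))"
      if K1: "(K1, B1) \<in> set_spmf ?p" for K1 B1
    proof -
      from p K1 True have adv: "advances E H \<gamma> K B K1 B1" and dec: "\<exists>i\<in>{1..k}. K1 i \<subset> K i" by auto
      have fK: "finite (K i)" for i using less.prems fH by (auto intro: finite_subset)
      have sub: "K2 K1 B1 i \<subseteq> K1 i" "K1 i \<subseteq> K i" for i
        using adv by (auto simp: advances_def K2_def)
      have "(\<Sum>i\<in>{1..k}. card (K2 K1 B1 i)) < (\<Sum>i\<in>{1..k}. card (K i))"
      proof (rule sum_strict_mono_ex1)
        show "\<forall>i\<in>{1..k}. card (K2 K1 B1 i) \<le> card (K i)"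
          using sub fK by (meson card_mono order_trans)
        from dec obtain i where "i \<in> {1..k}" "K1 i \<subset> K i" by blast
        moreover from this have "K2 K1 B1 i \<subset> K i" using sub[of i] by blast
        ultimately show "\<exists>i\<in>{1..k}. card (K2 K1 B1 i) < card (K i)"
          using fK psubset_card_mono by blast
      qed simp
      moreover have "\<forall>i. K2 K1 B1 i \<subseteq> H" using sub less.prems by blast
      ultimately have IH: "lossless_spmf (batch_loop E a e k N H \<gamma> (K2 K1 B1) B1) \<and>
        (\<forall>B' \<in> set_spmf (batch_loop E a e k N H \<gamma> (K2 K1 B1) B1).
          B1 \<subseteq> B' \<and> (frugal E H \<gamma> B1 \<longrightarrow> frugal E H \<gamma> B') \<and>
          (\<forall>i\<in>{1..k}. \<forall>v \<in> K2 K1 B1 i. settled E H \<gamma> B' v))"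
        by (rule less.hyps)
      have st: "settled E H \<gamma> B1 v" if "v \<in> K i" "v \<notin> K2 K1 B1 i" for v i
      proof (cases "v \<in> K1 i")
        case True
        then have "pruned a e H (H - ancestors_set E H B1) \<gamma> v" using that by (simp add: K2_def)
        moreover have "v \<in> H" using less.prems that by blast
        ultimately show ?thesis using settled_if_pruned[OF _ assms(3,1,2) _ assms(4)] by blast
      qed (use adv that in \<open>auto simp: advances_def\<close>)
      show ?thesis
      proof (intro conjI ballI impI)
        fix B' assume B': "B' \<in> set_spmf (batch_loop E a e k N H \<gamma> (K2 K1 B1) B1)"
        with IH have "B1 \<subseteq> B'" by blast
        with adv show "B \<subseteq> B'" by (auto simp: advances_def)
        show "frugal E H \<gamma> B'" if "frugal E H \<gamma> B"
          using that adv IH B' by (auto simp: advances_def)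
        fix i v assume "i \<in> {1..k}" "v \<in> K i"
        then show "settled E H \<gamma> B' v"
          using IH B' st[of v i] settled_mono[OF fH \<open>B1 \<subseteq> B'\<close>] by (cases "v \<in> K2 K1 B1 i") auto
      qed (use IH in blast)
    qed
    from p have "lossless_spmf ?p" by blast
    then show ?thesis unfolding eq
      by (rule bind_spmf_spec) (use q in fastforce)
  qed
qed

text \<open>The bucket is the least \<open>i \<ge> 1\<close> with
  \<open>e H v < 2 ^ (i + 1)\<close>. Minimality gives the lower bound unless \<open>i = 1\<close>,
  the bucket that is open below.\<close>

lemma bucket_cover:
  assumes "e H v < 8 * (real \<rho>)\<^sup>2" "\<rho> \<ge> 1" "v \<in> H"
  shows "\<exists>i \<in> {1..num_buckets \<rho>}. v \<in> bucket e H i"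
proof -
  let ?n = "nat \<lceil>log 2 (real \<rho>)\<rceil>"
  have "real \<rho> = 2 powr (log 2 (real \<rho>))" using assms(2) by simp
  also have "\<dots> \<le> 2 powr (real ?n)" by (intro powr_mono) linarith+
  finally have "real \<rho> \<le> 2 ^ ?n" by (simp add: powr_realpow)
  then have "(real \<rho>)\<^sup>2 \<le> (2 ^ ?n)\<^sup>2" by (intro power_mono) auto
  \<comment> \<open>The additive 2 in \<open>num_buckets\<close> is chosen for this: the exponent
    \<open>2 * ?n + 3\<close> produces the factor 8.\<close>
  also have "8 * (2 ^ ?n)\<^sup>2 = (2::real) ^ (num_buckets \<rho> + 1)"
    by (simp add: num_buckets_def power_add power_mult[symmetric] mult.commute)
  finally have big: "e H v < 2 ^ (num_buckets \<rho> + 1)" using assms(1) by linarith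
  define P where "P i \<longleftrightarrow> 1 \<le> i \<and> e H v < 2 ^ (i + 1)" for i
  have Pk: "P (num_buckets \<rho>)" using big by (simp add: P_def num_buckets_def)
  define i where "i = (LEAST i. P i)"
  have Pi: "P i" and ik: "i \<le> num_buckets \<rho>"
    unfolding i_def using Pk by (auto intro: LeastI Least_le)
  have "2 ^ i \<le> e H v" if "i \<noteq> 1"
  proof -
    have "i - 1 < i" using Pi by (simp add: P_def)
    then have "\<not> P (i - 1)" unfolding i_def by (rule not_less_Least)
    moreover have "i - 1 + 1 = i" "1 \<le> i - 1" using that Pi by (auto simp: P_def)
    ultimately show ?thesis by (simp add: P_def)
  qed
  then have "v \<in> bucket e H i" using Pi assms(3) by (auto simp: bucket_def P_def)
  then show ?thesis using Pi ik by (auto simp: P_def)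
qed

lemma find_batch_spec:
  assumes "finite V" "H \<subseteq> V" "estimates V E a e" "\<gamma> \<ge> 0" "N \<ge> 1" "\<rho> \<ge> 1"
    and small: "\<forall>v \<in> H. card (ancestors E H v) \<le> 2 * \<rho>"
  shows "lossless_spmf (find_batch E a e \<rho> N H \<gamma>) \<and>
    (\<forall>B \<in> set_spmf (find_batch E a e \<rho> N H \<gamma>). frugal E H \<gamma> B \<and> (\<forall>v \<in> H. settled E H \<gamma> B v))"
proof -
  have fH: "finite H" using assms by (auto intro: finite_subset)
  have cover: "\<exists>i \<in> {1..num_buckets \<rho>}. v \<in> bucket e H i" if v: "v \<in> H" for v
  proof (rule bucket_cover)
    have "card (ancestor_edges E H v) \<le> (2 * \<rho>)\<^sup>2"
      using card_ancestor_edges_le[OF fH, of E v] small v by (meson order_trans power_mono zero_le)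
    then have "real (card (ancestor_edges E H v)) \<le> real ((2 * \<rho>)\<^sup>2)" by (rule of_nat_mono)
    then have "real (card (ancestor_edges E H v)) \<le> 4 * (real \<rho>)\<^sup>2" by (simp add: power_mult_distrib)
    moreover have "\<bar>e H v - card (ancestor_edges E H v)\<bar> \<le> 1/3 * card (ancestor_edges E H v)"
      using assms v unfolding estimates_def by blast
    moreover have "(real \<rho>)\<^sup>2 > 0" using assms(6) by simp
    \<comment> \<open>The estimate is at most \<open>4/3 * (4 * \<rho>\<^sup>2)\<close>, and 16/3 is
      less than 8.\<close>
    ultimately show "e H v < 8 * (real \<rho>)\<^sup>2" by linarith
  qed (use assms v in auto)
  have "\<forall>i. bucket e H i \<subseteq> H" by (auto simp: bucket_def)
  note spec = batch_loop_spec[OF assms(1-4) this assms(5), of "num_buckets \<rho>" "{}"]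
  have "frugal E H \<gamma> {}" by (simp add: frugal_def)
  with spec cover show ?thesis unfolding find_batch_def by blast
qed

section \<open>List scheduling\<close>

lemma list_of_set_spec: "finite U \<Longrightarrow> distinct (list_of_set U) \<and> set (list_of_set U) = U"
  unfolding list_of_set_def by (rule someI_ex) (metis finite_distinct_list)

text \<open>Put a vertex without predecessors in \<open>U\<close> first and recurse. Forbidding
  edges from later to earlier entries by \<open>sorted_wrt\<close> suits this recursion better than
  the index condition of \<open>topological_list\<close>.\<close>

lemma acyclic_linearization:
  assumes "finite U" "acyclic E"
  shows "\<exists>xs. distinct xs \<and> set xs = U \<and> sorted_wrt (\<lambda>x y. (y, x) \<notin> E) xs"
  using assms(1)
proof (induction rule: finite_psubset_induct)
  case (psubset U)
  show ?case
  proof (cases "U = {}")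
    case False
    have "acyclic (E \<inter> U \<times> U)" using assms(2) by (rule acyclic_subset) blast
    moreover have "finite (E \<inter> U \<times> U)" using psubset by auto
    ultimately have "wf (E \<inter> U \<times> U)" by (rule finite_acyclic_wf[rotated])
    moreover from False obtain x where "x \<in> U" by blast
    ultimately obtain m where m: "m \<in> U" "\<forall>y \<in> U. (y, m) \<notin> E"
      by (rule wfE_min) blast
    have "U - {m} \<subset> U" using m(1) by blast
    from psubset.IH[OF this] obtain ys
      where ys: "distinct ys" "set ys = U - {m}" "sorted_wrt (\<lambda>x y. (y, x) \<notin> E) ys" by (elim exE conjE)
    have "\<forall>y \<in> set ys. (y, m) \<notin> E" unfolding ys(2) using m(2) by blast
    then have "sorted_wrt (\<lambda>x y. (y, x) \<notin> E) (m # ys)" using ys(3) by (simp only: sorted_wrt.simps)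
    moreover have "distinct (m # ys)" "set (m # ys) = U" using ys(1,2) m(1) by auto
    ultimately show ?thesis by (intro exI[of _ "m # ys"] conjI)
  qed simp
qed

lemma topological_list_exists:
  assumes "finite U" "acyclic E"
  shows "\<exists>xs. distinct xs \<and> set xs = U \<and>
     (\<forall>i < length xs. \<forall>j < length xs. (xs ! i, xs ! j) \<in> E \<longrightarrow> i < j)"
proof -
  obtain xs where xs: "distinct xs" "set xs = U" "sorted_wrt (\<lambda>x y. (y, x) \<notin> E) xs"
    using acyclic_linearization[OF assms] by blast
  have "i < j" if "i < length xs" "j < length xs" "(xs ! i, xs ! j) \<in> E" for i j
  proof (rule ccontr)
    assume "\<not> i < j"
    then consider "i = j" | "j < i" by linarith
    then show False
    proof cases
      case 1
      then show False using r_into_trancl[OF that(3)] assms(2) by (simp add: acyclic_def)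
    next
      case 2
      then show False using sorted_wrt_nth_less[OF xs(3) 2 that(1)] that(3) by simp
    qed
  qed
  with xs(1,2) show ?thesis by (intro exI[of _ xs] conjI allI impI)
qed

lemma topological_list_spec:
  assumes "finite U" "acyclic E"
  shows "distinct (topological_list E U)" "set (topological_list E U) = U"
    "\<And>i j. i < length (topological_list E U) \<Longrightarrow> j < length (topological_list E U) \<Longrightarrow>
       (topological_list E U ! i, topological_list E U ! j) \<in> E \<Longrightarrow> i < j"
proof -
  have "distinct (topological_list E U) \<and> set (topological_list E U) = U \<and>
     (\<forall>i < length (topological_list E U). \<forall>j < length (topological_list E U).
        (topological_list E U ! i, topological_list E U ! j) \<in> E \<longrightarrow> i < j)"
    unfolding topological_list_def by (rule someI_ex[OF topological_list_exists[OF assms]])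
  then show "distinct (topological_list E U)" "set (topological_list E U) = U"
    "\<And>i j. i < length (topological_list E U) \<Longrightarrow> j < length (topological_list E U) \<Longrightarrow>
       (topological_list E U ! i, topological_list E U ! j) \<in> E \<Longrightarrow> i < j"
    by blast+
qed

lemma length_topological_list:
  "finite U \<Longrightarrow> acyclic E \<Longrightarrow> length (topological_list E U) = card U"
  using distinct_card[of "topological_list E U"] topological_list_spec(1,2)[of U E] by simp

lemma list_schedule_snoc:
  "list_schedule E M T (As @ [A]) =
     (let (load, S) = list_schedule E M T As;
          \<mu> = arg_min_on load {..<M};
          xs = topological_list E A
      in (load(\<mu> := load \<mu> + length xs), S \<union> {(xs ! j, \<mu>, T + load \<mu> + j) | j. j < length xs}))"
  by (simp add: list_schedule_def split_beta Let_def)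

text \<open>Graham's argument for greedy list scheduling: the least loaded machine carries at most
  the average of the earlier total, and the new job adds at most \<open>L\<close>. The bound is
  multiplied by \<open>M\<close> to stay in \<open>nat\<close>. Precedence is stated for each copy
  with a set \<open>A\<close> of its own, since a job may lie in several of the sets.\<close>

lemma list_schedule_invariant:
  assumes "acyclic E" "M \<ge> 1" "\<forall>A \<in> set As. finite A \<and> card A \<le> L"
    and "list_schedule E M T As = (load, S)"
  shows "finite S \<and> (\<forall>v \<mu> t. (v, \<mu>, t) \<in> S \<longrightarrow> \<mu> < M \<and> T \<le> t \<and> t < T + load \<mu>) \<and>
    (\<forall>v \<mu> t. (v, \<mu>, t) \<in> S \<longrightarrow>
       (\<exists>A \<in> set As. v \<in> A \<and> (\<forall>u \<in> A. (u, v) \<in> E \<longrightarrow> (\<exists>t'. (u, \<mu>, t') \<in> S \<and> t' + 1 \<le> t)))) \<and>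
    fst ` S = \<Union>(set As) \<and>
    (\<forall>u v \<mu> t. (u, \<mu>, t) \<in> S \<and> (v, \<mu>, t) \<in> S \<longrightarrow> u = v) \<and>
    (\<Sum>\<mu><M. load \<mu>) = (\<Sum>A\<leftarrow>As. card A) \<and>
    (\<forall>\<mu><M. M * load \<mu> \<le> (\<Sum>A\<leftarrow>As. card A) + M * L)"
  using assms(3,4)
proof (induction As arbitrary: load S rule: rev_induct)
  case Nil
  then show ?case by (auto simp: list_schedule_def)
next
  case (snoc A As)
  obtain load0 S0 where eq0: "list_schedule E M T As = (load0, S0)" by fastforce
  have "\<forall>A \<in> set As. finite A \<and> card A \<le> L" using snoc.prems by simp
  note IH = snoc.IH[OF this eq0]
  define \<mu>0 where "\<mu>0 = arg_min_on load0 {..<M}"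
  define xs where "xs = topological_list E A"
  define S1 where "S1 = {(xs ! j, \<mu>0, T + load0 \<mu>0 + j) | j. j < length xs}"
  have load: "load = load0(\<mu>0 := load0 \<mu>0 + length xs)" and S: "S = S0 \<union> S1"
    using snoc.prems(2) by (auto simp: list_schedule_snoc eq0 Let_def \<mu>0_def xs_def S1_def)
  have A: "finite A" "card A \<le> L" using snoc.prems by auto
  note top = topological_list_spec[OF A(1) assms(1), folded xs_def]
  have len: "length xs = card A" unfolding xs_def by (rule length_topological_list[OF A(1) assms(1)])
  have ne: "finite {..<M}" "{..<M} \<noteq> {}" using assms(2) by (auto simp: lessThan_empty_iff)
  have \<mu>0: "\<mu>0 < M" using arg_min_if_finite(1)[OF ne] by (simp add: \<mu>0_def)
  have min: "load0 \<mu>0 \<le> load0 \<mu>" if "\<mu> < M" for \<mu>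
    using arg_min_least[OF ne, of \<mu> load0] that by (simp add: \<mu>0_def)
  have S1: "(v, \<mu>, t) \<in> S1 \<longleftrightarrow> \<mu> = \<mu>0 \<and> (\<exists>j < length xs. v = xs ! j \<and> t = T + load0 \<mu>0 + j)" for v \<mu> t
    by (auto simp: S1_def)
  have "S1 = (\<lambda>j. (xs ! j, \<mu>0, T + load0 \<mu>0 + j)) ` {..<length xs}" by (auto simp: S1_def)
  then have fin: "finite S" and "fst ` S1 = A"
    using IH top(2) by (auto simp: S image_image in_set_conv_nth)
  then have dom: "fst ` S = \<Union>(set (As @ [A]))" using IH by (simp add: S image_Un Un_commute)
  have range: "\<mu> < M \<and> T \<le> t \<and> t < T + load \<mu>" if "(v, \<mu>, t) \<in> S" for v \<mu> t
    using that unfolding S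
  proof
    assume "(v, \<mu>, t) \<in> S0"
    then have "\<mu> < M \<and> T \<le> t \<and> t < T + load0 \<mu>" using IH by blast
    then show ?thesis by (auto simp: load)
  next
    assume "(v, \<mu>, t) \<in> S1"
    then show ?thesis using \<mu>0 by (auto simp: S1 load)
  qed
  have pred: "\<exists>A' \<in> set (As @ [A]). v \<in> A' \<and>
      (\<forall>u \<in> A'. (u, v) \<in> E \<longrightarrow> (\<exists>t'. (u, \<mu>, t') \<in> S \<and> t' + 1 \<le> t))"
    if "(v, \<mu>, t) \<in> S" for v \<mu> t
    using that unfolding S
  proof
    assume "(v, \<mu>, t) \<in> S0"
    then obtain A' where "A' \<in> set As" "v \<in> A'"
      "\<forall>u \<in> A'. (u, v) \<in> E \<longrightarrow> (\<exists>t'. (u, \<mu>, t') \<in> S0 \<and> t' + 1 \<le> t)" using IH by blast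
    then show "\<exists>A' \<in> set (As @ [A]). v \<in> A' \<and>
      (\<forall>u \<in> A'. (u, v) \<in> E \<longrightarrow> (\<exists>t'. (u, \<mu>, t') \<in> S0 \<union> S1 \<and> t' + 1 \<le> t))"
      by (intro bexI[of _ A']) auto
  next
    assume "(v, \<mu>, t) \<in> S1"
    then obtain j where j: "\<mu> = \<mu>0" "j < length xs" "v = xs ! j" "t = T + load0 \<mu>0 + j"
      by (auto simp: S1)
    have "\<exists>t'. (u, \<mu>, t') \<in> S0 \<union> S1 \<and> t' + 1 \<le> t" if "u \<in> A" "(u, v) \<in> E" for u
    proof -
      from that(1) top(2) obtain i where i: "i < length xs" "u = xs ! i" by (metis in_set_conv_nth)
      then have "i < j" using top(3) j that(2) by blast
      then show ?thesis using i j by (intro exI[of _ "T + load0 \<mu>0 + i"]) (auto simp: S1)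
    qed
    moreover have "v \<in> A" using j top(2) by auto
    ultimately show "\<exists>A' \<in> set (As @ [A]). v \<in> A' \<and>
      (\<forall>u \<in> A'. (u, v) \<in> E \<longrightarrow> (\<exists>t'. (u, \<mu>, t') \<in> S0 \<union> S1 \<and> t' + 1 \<le> t))"
      by (intro bexI[of _ A]) auto
  qed
  \<comment> \<open>Machine \<open>\<mu>0\<close> is free from \<open>T + load0 \<mu>0\<close> on,
    where the new copies start, so no slot is used twice.\<close>
  have before: "t < T + load0 \<mu>0" if "(u, \<mu>0, t) \<in> S0" for u t
    using that IH by blast
  have uniq0: "u = v" if "(u, \<mu>, t) \<in> S0" "(v, \<mu>, t) \<in> S0" for u v \<mu> t
    using that IH by blast
  have uniq: "u = v" if "(u, \<mu>, t) \<in> S" "(v, \<mu>, t) \<in> S" for u v \<mu> t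
    using that uniq0[of u \<mu> t v] unfolding S by (auto simp: S1 dest!: before)
  have sum: "(\<Sum>\<mu><M. load \<mu>) = (\<Sum>A\<leftarrow>As @ [A]. card A)"
  proof -
    have "(\<Sum>\<mu><M. load \<mu>) = (\<Sum>\<mu><M. load0 \<mu> + (if \<mu> = \<mu>0 then card A else 0))"
      by (rule sum.cong) (auto simp: load len)
    also have "\<dots> = (\<Sum>\<mu><M. load0 \<mu>) + card A"
      using \<mu>0 by (simp add: sum.distrib)
    finally show ?thesis using IH by simp
  qed
  have bound: "M * load \<mu> \<le> (\<Sum>A\<leftarrow>As @ [A]. card A) + M * L" if "\<mu> < M" for \<mu>
  proof (cases "\<mu> = \<mu>0")
    case True
    \<comment> \<open>The minimum is at most the average; the invariant on the sum of the loads
      identifies \<open>M\<close> times the average with the total work.\<close>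
    have "M * load0 \<mu>0 = (\<Sum>\<mu><M. load0 \<mu>0)" by simp
    also have "\<dots> \<le> (\<Sum>\<mu><M. load0 \<mu>)" using min by (intro sum_mono) auto
    finally have "M * load0 \<mu>0 \<le> (\<Sum>A\<leftarrow>As. card A)" using IH by simp
    moreover have "M * card A \<le> M * L" using A(2) by (rule mult_le_mono2)
    moreover have "M * load \<mu> = M * load0 \<mu>0 + M * card A"
      by (simp add: load len True add_mult_distrib2)
    moreover have "(\<Sum>A\<leftarrow>As @ [A]. card A) = (\<Sum>A\<leftarrow>As. card A) + card A" by simp
    ultimately show ?thesis by linarith
  next
    case False
    have "M * load0 \<mu> \<le> (\<Sum>A\<leftarrow>As. card A) + M * L" using IH that by blast
    with False show ?thesis by (simp add: load)
  qed
  show ?case using fin range pred dom uniq sum bound by blast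
qed

lemma list_schedule_spec:
  assumes "acyclic E" "M \<ge> 1" "\<forall>A \<in> set As. finite A \<and> card A \<le> L"
    and "list_schedule E M T As = (load, S)"
  shows "finite S" "fst ` S = \<Union>(set As)"
    and "(v, \<mu>, t) \<in> S \<Longrightarrow> \<mu> < M \<and> T \<le> t \<and> t < T + load \<mu>"
    and "(v, \<mu>, t) \<in> S \<Longrightarrow>
      \<exists>A \<in> set As. v \<in> A \<and> (\<forall>u \<in> A. (u, v) \<in> E \<longrightarrow> (\<exists>t'. (u, \<mu>, t') \<in> S \<and> t' + 1 \<le> t))"
    and "(u, \<mu>, t) \<in> S \<Longrightarrow> (v, \<mu>, t) \<in> S \<Longrightarrow> u = v"
    and "\<mu> < M \<Longrightarrow> M * load \<mu> \<le> (\<Sum>A\<leftarrow>As. card A) + M * L"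
proof -
  note inv = list_schedule_invariant[OF assms]
  show "finite S" by (rule inv[THEN conjunct1])
  note inv = inv[THEN conjunct2]
  show "(v, \<mu>, t) \<in> S \<Longrightarrow> \<mu> < M \<and> T \<le> t \<and> t < T + load \<mu>"
    by (rule inv[THEN conjunct1, rule_format])
  note inv = inv[THEN conjunct2]
  show "(v, \<mu>, t) \<in> S \<Longrightarrow>
      \<exists>A \<in> set As. v \<in> A \<and> (\<forall>u \<in> A. (u, v) \<in> E \<longrightarrow> (\<exists>t'. (u, \<mu>, t') \<in> S \<and> t' + 1 \<le> t))"
    by (rule inv[THEN conjunct1, THEN spec, THEN spec, THEN spec, THEN mp])
  note inv = inv[THEN conjunct2]
  show "fst ` S = \<Union>(set As)" by (rule inv[THEN conjunct1])
  note inv = inv[THEN conjunct2]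
  show "(u, \<mu>, t) \<in> S \<Longrightarrow> (v, \<mu>, t) \<in> S \<Longrightarrow> u = v"
    by (rule inv[THEN conjunct1, rule_format, OF conjI])
  note inv = inv[THEN conjunct2]
  show "\<mu> < M \<Longrightarrow> M * load \<mu> \<le> (\<Sum>A\<leftarrow>As. card A) + M * L"
    by (rule inv[THEN conjunct2, rule_format])
qed

section \<open>Extending a valid schedule by one batch\<close>

lemma valid_scheduleD:
  assumes "valid_schedule V E M \<rho> S"
  shows "finite S"
    and "(v, \<mu>, t) \<in> S \<Longrightarrow> v \<in> V \<and> \<mu> < M"
    and "v \<in> V \<Longrightarrow> \<exists>\<mu> t. (v, \<mu>, t) \<in> S"
    and "(u, \<mu>, t) \<in> S \<Longrightarrow> (v, \<mu>, t) \<in> S \<Longrightarrow> u = v"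
    and "(v, \<mu>, t) \<in> S \<Longrightarrow> (u, v) \<in> E \<Longrightarrow>
      (\<exists>t'. (u, \<mu>, t') \<in> S \<and> t' + 1 \<le> t) \<or>
      (\<exists>\<mu>' t'. \<mu>' \<noteq> \<mu> \<and> (u, \<mu>', t') \<in> S \<and> t' + 1 + \<rho> \<le> t)"
proof -
  note valid = assms[unfolded valid_schedule_def]
  show "finite S" by (rule valid[THEN conjunct1])
  note valid = valid[THEN conjunct2]
  show "(v, \<mu>, t) \<in> S \<Longrightarrow> v \<in> V \<and> \<mu> < M"
    using bspec[OF valid[THEN conjunct1], of "(v, \<mu>, t)"] by simp
  note valid = valid[THEN conjunct2]
  show "v \<in> V \<Longrightarrow> \<exists>\<mu> t. (v, \<mu>, t) \<in> S" by (rule bspec[OF valid[THEN conjunct1]])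
  note valid = valid[THEN conjunct2]
  show "(u, \<mu>, t) \<in> S \<Longrightarrow> (v, \<mu>, t) \<in> S \<Longrightarrow> u = v"
    by (rule valid[THEN conjunct1, rule_format, OF conjI])
  show "(v, \<mu>, t) \<in> S \<Longrightarrow> (u, v) \<in> E \<Longrightarrow>
      (\<exists>t'. (u, \<mu>, t') \<in> S \<and> t' + 1 \<le> t) \<or>
      (\<exists>\<mu>' t'. \<mu>' \<noteq> \<mu> \<and> (u, \<mu>', t') \<in> S \<and> t' + 1 + \<rho> \<le> t)"
    using bspec[OF valid[THEN conjunct2], of "(v, \<mu>, t)"] by simp
qed

text \<open>From time \<open>T\<close> on, every job in \<open>D\<close> is available on every
  machine. Validity for \<open>D\<close> keeps all edges of \<open>E\<close>, also those that enter
  \<open>D\<close> from outside, and so forces \<open>D\<close> to be closed under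
  predecessors.\<close>

definition ready :: "'v set \<Rightarrow> ('v \<times> 'v) set \<Rightarrow> nat \<Rightarrow> nat \<Rightarrow> nat \<Rightarrow> 'v schedule \<Rightarrow> bool" where
  "ready D E M \<rho> T S \<longleftrightarrow> valid_schedule D E M \<rho> S \<and> (\<forall>(v, \<mu>, t) \<in> S. t + 1 + \<rho> \<le> T)"

text \<open>
  A predecessor inside \<open>H\<close> runs earlier on the same machine; one outside \<open>H\<close> has completed
  \<open>\<rho>\<close> slots before \<open>T\<close>.
\<close>

lemma ready_batch:
  assumes "ready D E M \<rho> T S" "acyclic E" "M \<ge> 1" "finite H"
    and preds: "\<forall>v \<in> H. \<forall>u. (u, v) \<in> E \<longrightarrow> u \<in> D \<union> H"
    and "list_schedule E M T (map (ancestors E H) bs) = (load, S')"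
  shows "ready (D \<union> ancestors_set E H (set bs)) E M \<rho> (T + Max (load ` {..<M}) + \<rho>) (S \<union> S')"
proof -
  let ?As = "map (ancestors E H) bs" and ?D = "D \<union> ancestors_set E H (set bs)"
  \<comment> \<open>A crude bound on the job lengths is enough for validity; the sharper
    \<open>2 * \<rho>\<close> is applied where the loads are estimated.\<close>
  have "\<forall>A \<in> set ?As. finite A \<and> card A \<le> card H"
    using assms(4) by (auto intro!: card_mono ancestors_subset finite_ancestors)
  note spec = list_schedule_spec[OF assms(2,3) this assms(6)]
  have U: "\<Union>(set ?As) = ancestors_set E H (set bs)" by (simp add: ancestors_set_def)
  have dom: "fst ` S' = ancestors_set E H (set bs)" using spec(2) unfolding U .
  have before: "t + 1 + \<rho> \<le> T" if "(v, \<mu>, t) \<in> S" for v \<mu> t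
    using assms(1) that by (auto simp: ready_def)
  have valid: "valid_schedule D E M \<rho> S" using assms(1) by (simp add: ready_def)
  have after: "\<mu> < M" "T \<le> t" "t < T + load \<mu>" if "(v, \<mu>, t) \<in> S'" for v \<mu> t
    using spec(3)[OF that] by auto
  note validD = valid_scheduleD[OF valid]
  have "valid_schedule ?D E M \<rho> (S \<union> S')"
    unfolding valid_schedule_def
  proof (intro conjI)
    show "finite (S \<union> S')" using validD(1) spec(1) by simp
    show "\<forall>(v, \<mu>, t) \<in> S \<union> S'. v \<in> ?D \<and> \<mu> < M"
    proof
      fix x assume "x \<in> S \<union> S'"
      moreover obtain v \<mu> t where "x = (v, \<mu>, t)" by (cases x)
      ultimately have x: "x \<in> S \<union> S'" "x = (v, \<mu>, t)" by simp_all
      have "v \<in> ?D \<and> \<mu> < M"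
      proof (cases "x \<in> S")
        case True
        then show ?thesis using validD(2)[of v \<mu> t] x(2) by simp
      next
        case False
        with x have x': "(v, \<mu>, t) \<in> S'" by simp
        then have "v \<in> fst ` S'" by force
        then show ?thesis using after(1)[OF x'] dom by blast
      qed
      then show "case x of (v, \<mu>, t) \<Rightarrow> v \<in> ?D \<and> \<mu> < M" unfolding x(2) prod.case .
    qed
    show "\<forall>v \<in> ?D. \<exists>\<mu> t. (v, \<mu>, t) \<in> S \<union> S'"
    proof
      fix v assume v: "v \<in> ?D"
      show "\<exists>\<mu> t. (v, \<mu>, t) \<in> S \<union> S'"
      proof (cases "v \<in> D")
        case True
        from validD(3)[OF this] show ?thesis by blast
      next
        case False
        with v have "v \<in> fst ` S'" using dom by simp
        then show ?thesis by force
      qed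
    qed
    show "\<forall>u v \<mu> t. (u, \<mu>, t) \<in> S \<union> S' \<and> (v, \<mu>, t) \<in> S \<union> S' \<longrightarrow> u = v"
    proof (intro allI impI)
      fix u v \<mu> t assume uv: "(u, \<mu>, t) \<in> S \<union> S' \<and> (v, \<mu>, t) \<in> S \<union> S'"
      \<comment> \<open>Old copies end by time \<open>T\<close>, and new copies start at
        \<open>T\<close> or later.\<close>
      have "\<not> ((x, \<mu>, t) \<in> S \<and> (y, \<mu>, t) \<in> S')" for x y
        using before[of x \<mu> t] after(2)[of y \<mu> t] by force
      with uv have "(u, \<mu>, t) \<in> S \<and> (v, \<mu>, t) \<in> S \<or> (u, \<mu>, t) \<in> S' \<and> (v, \<mu>, t) \<in> S'" by blast
      then show "u = v" using validD(4) spec(5) by (elim disjE conjE)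
    qed
    show "\<forall>(v, \<mu>, t) \<in> S \<union> S'. \<forall>u. (u, v) \<in> E \<longrightarrow>
        (\<exists>t'. (u, \<mu>, t') \<in> S \<union> S' \<and> t' + 1 \<le> t) \<or>
        (\<exists>\<mu>' t'. \<mu>' \<noteq> \<mu> \<and> (u, \<mu>', t') \<in> S \<union> S' \<and> t' + 1 + \<rho> \<le> t)"
    proof
      fix x assume "x \<in> S \<union> S'"
      moreover obtain v \<mu> t where "x = (v, \<mu>, t)" by (cases x)
      ultimately have x: "x \<in> S \<union> S'" "x = (v, \<mu>, t)" by simp_all
      have "(\<exists>t'. (u, \<mu>, t') \<in> S \<union> S' \<and> t' + 1 \<le> t) \<or>
        (\<exists>\<mu>' t'. \<mu>' \<noteq> \<mu> \<and> (u, \<mu>', t') \<in> S \<union> S' \<and> t' + 1 + \<rho> \<le> t)" if uv: "(u, v) \<in> E" for u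
      proof (cases "x \<in> S")
        case True
        with validD(5)[OF _ uv, of \<mu> t] x(2) show ?thesis by blast
      next
        case False
        with x have x': "(v, \<mu>, t) \<in> S'" by simp
        from spec(4)[OF this] obtain A where A: "A \<in> set ?As" "v \<in> A"
          "\<forall>u \<in> A. (u, v) \<in> E \<longrightarrow> (\<exists>t'. (u, \<mu>, t') \<in> S' \<and> t' + 1 \<le> t)" by blast
        from A(1) obtain b where b: "A = ancestors E H b" by auto
        have "v \<in> H" using A(2) ancestors_subset[of E H b] unfolding b by blast
        show ?thesis
        proof (cases "u \<in> H")
          case True
          then have "u \<in> A" using predecessor_in_ancestors[OF uv True] A(2) unfolding b by blast
          from A(3)[THEN bspec, OF this, THEN mp, OF uv] show ?thesis by blast
        next
          case False
          then have "u \<in> D" using preds \<open>v \<in> H\<close> uv by blast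
          from validD(3)[OF this] obtain \<mu>' t' where c: "(u, \<mu>', t') \<in> S" by blast
          then have "t' + 1 + \<rho> \<le> t" using before[OF c] after(2)[OF x'] by linarith
          then show ?thesis using c by (cases "\<mu>' = \<mu>") auto
        qed
      qed
      then show "case x of (v, \<mu>, t) \<Rightarrow> \<forall>u. (u, v) \<in> E \<longrightarrow>
          (\<exists>t'. (u, \<mu>, t') \<in> S \<union> S' \<and> t' + 1 \<le> t) \<or>
          (\<exists>\<mu>' t'. \<mu>' \<noteq> \<mu> \<and> (u, \<mu>', t') \<in> S \<union> S' \<and> t' + 1 + \<rho> \<le> t)"
        unfolding x(2) prod.case by (intro allI impI)
    qed
  qed
  moreover have "t + 1 + \<rho> \<le> T + Max (load ` {..<M}) + \<rho>" if "(v, \<mu>, t) \<in> S \<union> S'" for v \<mu> t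
  proof (cases "(v, \<mu>, t) \<in> S")
    case False
    with that have "(v, \<mu>, t) \<in> S'" by simp
    note after[OF this]
    moreover from this have "load \<mu> \<le> Max (load ` {..<M})" by (intro Max_ge) auto
    ultimately show ?thesis by linarith
  next
    case True
    from before[OF this] show ?thesis by linarith
  qed
  ultimately show ?thesis unfolding ready_def by blast
qed

section \<open>Counting the batches of a small subgraph\<close>

text \<open>A budget of \<open>j\<close> further batches. It is not known which of the two counts a
  batch shrinks, but the other one cannot grow, so the product is the potential. One batch is
  reserved for the vertices without ancestor edges, hence the exponent \<open>j - 1\<close>.\<close>

definition within_batches :: "('v \<times> 'v) set \<Rightarrow> real \<Rightarrow> nat \<Rightarrow> 'v set \<Rightarrow> bool" where
  "within_batches E \<gamma> j H \<longleftrightarrow> (j = 0 \<longrightarrow> H = {}) \<and>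
     (\<forall>v \<in> H. ancestor_edges E H v \<noteq> {} \<longrightarrow>
        (4 * \<gamma>) ^ (j - 1) * (real (card (ancestors E H v)) * real (card (ancestor_edges E H v))) < 1)"

text \<open>
  A batch shrinks the number of ancestors or the number of ancestor edges of every remaining
  vertex by the factor \<open>4\<gamma>\<close>, hence also their product. Once the product is below \<open>1\<close>, there are no
  edges left, and a last batch removes everything.
\<close>

lemma within_batches_step:
  assumes "within_batches E \<gamma> (Suc j) H" "finite H" "0 < \<gamma>" "4 * \<gamma> < 1"
    and settled: "\<forall>v \<in> H. settled E H \<gamma> B v"
  shows "within_batches E \<gamma> j (H - ancestors_set E H B)"
proof -
  let ?H = "H - ancestors_set E H B"
  have sub: "?H \<subseteq> H" and fin: "finite ?H" using assms(2) by auto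
  have pos: "card (ancestors E X v) > 0" if "v \<in> X" "finite X" for X v
    using self_in_ancestors[OF that(1), of E] finite_ancestors[OF that(2), of E v]
    by (auto simp: card_gt_0_iff)
  have dec: "real (card (ancestors E ?H v)) * real (card (ancestor_edges E ?H v))
      \<le> 4 * \<gamma> * (real (card (ancestors E H v)) * real (card (ancestor_edges E H v)))"
    if "v \<in> ?H" for v
  proof -
    have a: "real (card (ancestors E ?H v)) \<le> real (card (ancestors E H v))"
      using card_mono[OF finite_ancestors[OF assms(2)] ancestors_mono[OF sub]] by simp
    have e: "real (card (ancestor_edges E ?H v)) \<le> real (card (ancestor_edges E H v))"
      using card_mono[OF finite_ancestor_edges[OF assms(2)] ancestor_edges_mono[OF sub]] by simp
    have "settled E H \<gamma> B v" using settled that by blast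
    then consider "real (card (ancestors E ?H v)) \<le> 4 * \<gamma> * real (card (ancestors E H v))"
      | "real (card (ancestor_edges E ?H v)) \<le> 4 * \<gamma> * real (card (ancestor_edges E H v))"
      unfolding settled_def by blast
    then show ?thesis
    proof cases
      case 1
      from mult_mono[OF 1 e] show ?thesis using assms(3) by (simp add: mult.assoc)
    next
      case 2
      from mult_mono[OF a 2] show ?thesis using assms(3) by (simp add: mult_ac)
    qed
  qed
  have "?H = {}" if "j = 0"
  proof (rule ccontr)
    assume "?H \<noteq> {}"
    then obtain v where v: "v \<in> ?H" by blast
    \<comment> \<open>With one batch left the exponent is zero, so an ancestor edge would make a
      product of two positive integers smaller than 1.\<close>
    have "ancestor_edges E H v = {}"
    proof (rule ccontr)
      assume ne: "ancestor_edges E H v \<noteq> {}"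
      then have "card (ancestor_edges E H v) \<ge> 1" "card (ancestors E H v) \<ge> 1"
        using finite_ancestor_edges[OF assms(2), of E v] pos[of v H] v assms(2)
        by (auto simp: Suc_le_eq card_gt_0_iff)
      then have "card (ancestors E H v) * card (ancestor_edges E H v) \<ge> 1 * 1" by (rule mult_le_mono[rotated])
      then have "real (1 * 1) \<le> real (card (ancestors E H v) * card (ancestor_edges E H v))"
        by (rule of_nat_mono)
      then have "real (card (ancestors E H v)) * real (card (ancestor_edges E H v)) \<ge> 1"
        by (simp only: of_nat_mult of_nat_1 mult_1)
      moreover have "real (card (ancestors E H v)) * real (card (ancestor_edges E H v)) < 1"
        using assms(1) ne v that by (auto simp: within_batches_def)
      ultimately show False by linarith
    qed
    moreover from this have "ancestors E H v = {v}"
      by (rule ancestors_without_edges) (use v in simp)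
    moreover have "settled E H \<gamma> B v" using settled v by blast
    \<comment> \<open>Only the first disjunct of \<open>settled\<close> is possible here, and
      \<open>v\<close> has one ancestor in \<open>H\<close>. So the rest contains fewer than one
      ancestor of \<open>v\<close>, although \<open>v\<close> itself is in it.\<close>
    ultimately have "real (card (ancestors E ?H v)) \<le> 4 * \<gamma>" by (simp add: settled_def)
    then show False using assms(4) pos[OF v fin] by linarith
  qed
  moreover have "(4 * \<gamma>) ^ (j - 1) * (real (card (ancestors E ?H v)) * real (card (ancestor_edges E ?H v))) < 1"
    if v: "v \<in> ?H" and ne: "ancestor_edges E ?H v \<noteq> {}" and j: "j \<noteq> 0" for v
  proof -
    have "ancestor_edges E H v \<noteq> {}" using ne ancestor_edges_mono[OF sub, of E v] by blast
    then have bound: "(4 * \<gamma>) ^ j * (real (card (ancestors E H v)) * real (card (ancestor_edges E H v))) < 1"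
      using assms(1) v by (auto simp: within_batches_def)
    have pow: "(4 * \<gamma>) ^ (j - 1) * (4 * \<gamma>) = (4 * \<gamma>) ^ j"
      using power_minus_mult[of j "4 * \<gamma>"] j by blast
    have "(4 * \<gamma>) ^ (j - 1) * (real (card (ancestors E ?H v)) * real (card (ancestor_edges E ?H v)))
      \<le> (4 * \<gamma>) ^ (j - 1) * (4 * \<gamma> * (real (card (ancestors E H v)) * real (card (ancestor_edges E H v))))"
      using dec[OF v] assms(3) by (intro mult_left_mono) auto
    also have "\<dots> = (4 * \<gamma>) ^ j * (real (card (ancestors E H v)) * real (card (ancestor_edges E H v)))"
      by (subst pow[symmetric]) (simp only: mult.assoc)
    finally show ?thesis using bound by linarith
  qed
  ultimately show ?thesis unfolding within_batches_def by blast
qed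

text \<open>The budget \<open>j\<close> bounds the number of batches, so induction on it also yields
  losslessness. Beyond its volume a batch costs at most \<open>3 * \<rho>\<close>:
  \<open>2 * \<rho>\<close> for the longest job in the greedy bound and \<rho> for the delay. The
  volume term telescopes, as \<open>card H\<close> drops by the number of vertices removed.\<close>

lemma schedule_small_subgraph_spec:
  assumes "dag V E" "M \<ge> 1" "\<rho> \<ge> 1" "N \<ge> 1" "estimates V E a e" "0 < \<gamma>" "4 * \<gamma> < 1"
    and "H \<subseteq> V" "within_batches E \<gamma> j H" "\<forall>v \<in> H. card (ancestors E H v) \<le> 2 * \<rho>"
    and "\<forall>v \<in> H. \<forall>u. (u, v) \<in> E \<longrightarrow> u \<in> D \<union> H" "ready D E M \<rho> T S"
  shows "lossless_spmf (schedule_small_subgraph E a e M \<rho> N \<gamma> H T S) \<and>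
    (\<forall>(T', S') \<in> set_spmf (schedule_small_subgraph E a e M \<rho> N \<gamma> H T S).
       ready (D \<union> H) E M \<rho> T' S' \<and>
       real T' \<le> real T + real (card H) / (\<gamma> * real M) + 3 * real \<rho> * real j)"
  using assms(8-12)
proof (induction j arbitrary: H D T S)
  case 0
  then have "H = {}" by (simp add: within_batches_def)
  then show ?case using 0 by (subst (1 2) schedule_small_subgraph.simps) simp
next
  case (Suc j)
  show ?case
  proof (cases "H = {}")
    case True
    then show ?thesis using Suc.prems by (subst (1 2) schedule_small_subgraph.simps) simp
  next
    case False
    have fV: "finite V" and acyc: "acyclic E" using assms(1) by (auto simp: dag_def)
    have fH: "finite H" using fV Suc.prems(1) by (rule finite_subset[rotated])
    let ?p = "find_batch E a e \<rho> N H \<gamma>"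
    define f where "f B = (let (load, S') = list_schedule E M T (map (ancestors E H) (list_of_set B))
          in schedule_small_subgraph E a e M \<rho> N \<gamma> (H - ancestors_set E H B)
               (T + Max (load ` {..<M}) + \<rho>) (S \<union> S'))" for B
    have eq: "schedule_small_subgraph E a e M \<rho> N \<gamma> H T S = bind_spmf ?p f"
      using False by (subst schedule_small_subgraph.simps) (simp add: f_def[abs_def])
    note p = find_batch_spec[OF fV Suc.prems(1) assms(5) less_imp_le[OF assms(6)] assms(4,3) Suc.prems(3)]
    show ?thesis unfolding eq
    proof (rule bind_spmf_spec)
      show "lossless_spmf ?p" using p by blast
      fix B assume "B \<in> set_spmf ?p"
      with p have fru: "frugal E H \<gamma> B" and st: "\<forall>v \<in> H. settled E H \<gamma> B v" by auto
      have BH: "B \<subseteq> H" using fru by (simp add: frugal_def)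
      then have "finite B" using fH by (rule finite_subset)
      then have bs: "distinct (list_of_set B)" "set (list_of_set B) = B" using list_of_set_spec by auto
      let ?As = "map (ancestors E H) (list_of_set B)"
      obtain load S' where ls: "list_schedule E M T ?As = (load, S')" by fastforce
      let ?H = "H - ancestors_set E H B" and ?T = "T + Max (load ` {..<M}) + \<rho>"
      have f: "f B = schedule_small_subgraph E a e M \<rho> N \<gamma> ?H ?T (S \<union> S')"
        by (simp add: f_def ls)
      have ready: "ready (D \<union> ancestors_set E H B) E M \<rho> ?T (S \<union> S')"
        using ready_batch[OF Suc.prems(5) acyc assms(2) fH Suc.prems(4) ls] bs by simp
      have "\<forall>v \<in> ?H. card (ancestors E ?H v) \<le> 2 * \<rho>"
        using Suc.prems(3) card_mono[OF finite_ancestors[OF fH] ancestors_mono[of ?H H E]]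
        by (meson Diff_iff Diff_subset order_trans)
      moreover have "\<forall>v \<in> ?H. \<forall>u. (u, v) \<in> E \<longrightarrow> u \<in> (D \<union> ancestors_set E H B) \<union> ?H"
        using Suc.prems(4) by blast
      moreover have "?H \<subseteq> V" using Suc.prems(1) by blast
      ultimately have IH: "lossless_spmf (f B) \<and> (\<forall>(T', S'') \<in> set_spmf (f B).
          ready (D \<union> ancestors_set E H B \<union> ?H) E M \<rho> T' S'' \<and>
          real T' \<le> real ?T + real (card ?H) / (\<gamma> * real M) + 3 * real \<rho> * real j)"
        unfolding f using ready within_batches_step[OF Suc.prems(2) fH assms(6,7) st]
        by (intro Suc.IH)
      have un: "D \<union> ancestors_set E H B \<union> ?H = D \<union> H" using ancestors_set_subset[of E H B] by blast
      have "Max (load ` {..<M}) \<in> load ` {..<M}" using assms(2) by (intro Max_in) (auto simp: lessThan_empty_iff)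
      then obtain \<mu> where \<mu>: "\<mu> < M" "Max (load ` {..<M}) = load \<mu>" by auto
      have "\<forall>A \<in> set ?As. finite A \<and> card A \<le> 2 * \<rho>"
        using Suc.prems(3) BH bs finite_ancestors[OF fH] by auto
      from list_schedule_spec(6)[OF acyc assms(2) this ls \<mu>(1)]
      have "M * load \<mu> \<le> (\<Sum>A\<leftarrow>?As. card A) + M * (2 * \<rho>)" .
      also have "(\<Sum>A\<leftarrow>?As. card A) = (\<Sum>b\<in>B. card (ancestors E H b))"
        using sum_list_distinct_conv_sum_set[OF bs(1), of "\<lambda>b. card (ancestors E H b)"] bs(2)
        by (simp add: comp_def)
      finally have "real (M * load \<mu>) \<le> real ((\<Sum>b\<in>B. card (ancestors E H b)) + M * (2 * \<rho>))"
        by (rule of_nat_mono)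
      then have "\<gamma> * (real M * real (load \<mu>))
          \<le> \<gamma> * ((\<Sum>b\<in>B. real (card (ancestors E H b))) + real M * (2 * real \<rho>))"
        using assms(6) by (intro mult_left_mono) simp_all
      also have "\<dots> \<le> real (card (ancestors_set E H B)) + \<gamma> * (real M * (2 * real \<rho>))"
        using fru by (simp add: frugal_def distrib_left)
      finally have "real (load \<mu>) \<le> real (card (ancestors_set E H B)) / (\<gamma> * real M) + 2 * real \<rho>"
        using assms(2,6) by (simp add: field_simps)
      moreover have "real (card H) = real (card (ancestors_set E H B)) + real (card ?H)"
        using card_Diff_subset[OF finite_ancestors_set[OF fH] ancestors_set_subset, of E B]
          card_mono[OF fH ancestors_set_subset, of E B] by simp
      ultimately have "real ?T + real (card ?H) / (\<gamma> * real M) + 3 * real \<rho> * real j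
          \<le> real T + real (card H) / (\<gamma> * real M) + 3 * real \<rho> * real (Suc j)"
        unfolding \<mu>(2) by (simp add: add_divide_distrib algebra_simps)
      then show "lossless_spmf (f B) \<and> (\<forall>(T', S'') \<in> set_spmf (f B).
          ready (D \<union> H) E M \<rho> T' S'' \<and>
          real T' \<le> real T + real (card H) / (\<gamma> * real M) + 3 * real \<rho> * real (Suc j))"
        using IH unfolding un by (auto simp: case_prod_beta intro: order_trans)
    qed
  qed
qed

section \<open>Small subgraphs\<close>

text \<open>Once the queue is empty, the last clause says that a vertex left out although all its
  predecessors were accepted has too large an estimate. Disjointness of queue and \<open>U\<close>
  makes every accepted vertex new, which termination needs.\<close>

definition small_subgraph_inv ::
  "('v \<times> 'v) set \<Rightarrow> ('v set \<Rightarrow> 'v \<Rightarrow> real) \<Rightarrow> nat \<Rightarrow> 'v set \<Rightarrow> 'v list \<times> 'v set \<Rightarrow> bool" where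
  "small_subgraph_inv E a \<rho> G = (\<lambda>(Q, U).
     U \<subseteq> G \<and> set Q \<subseteq> G \<and> distinct Q \<and> set Q \<inter> U = {} \<and>
     (\<forall>v \<in> U. a G v \<le> 4/3 * real \<rho>) \<and>
     (\<forall>v \<in> U \<union> set Q. predecessors E G v \<subseteq> U) \<and>
     (\<forall>v \<in> G. predecessors E G v \<subseteq> U \<longrightarrow> v \<in> U \<union> set Q \<or> a G v > 4/3 * real \<rho>))"

text \<open>An accepted or queued vertex has all its predecessors in \<open>U\<close>, whereas each
  newly enqueued one has the predecessor \<open>v\<close>, which is not in \<open>U\<close> yet. So
  the new entries are disjoint from the old ones. A vertex that becomes eligible in this step must
  have \<open>v\<close> as its last missing predecessor, so none is overlooked.\<close>

lemma small_subgraph_inv_accept: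
  assumes inv: "small_subgraph_inv E a \<rho> G (v # Q, U)" and le: "a G v \<le> 4/3 * real \<rho>"
    and "finite G" "acyclic E"
  shows "small_subgraph_inv E a \<rho> G
    (Q @ list_of_set {w \<in> G. (v, w) \<in> E \<and> predecessors E G w \<subseteq> insert v U}, insert v U)"
proof -
  define W where "W = {w \<in> G. (v, w) \<in> E \<and> predecessors E G w \<subseteq> insert v U}"
  have W: "distinct (list_of_set W)" "set (list_of_set W) = W"
    using list_of_set_spec[of W] assms(3) by (auto simp: W_def)
  have vG: "v \<in> G" "v \<notin> U" "v \<notin> set Q" "set Q \<inter> U = {}" using inv by (auto simp: small_subgraph_inv_def)
  have pred: "predecessors E G w \<subseteq> U" if "w \<in> U \<union> set (v # Q)" for w
    using inv that by (auto simp: small_subgraph_inv_def)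
  have vW: "v \<in> predecessors E G w" if "w \<in> W" for w
    using that vG by (auto simp: W_def predecessors_def)
  have new: "w \<notin> U \<union> set (v # Q)" if "w \<in> W" for w
  proof
    assume "w \<in> U \<union> set (v # Q)"
    from subsetD[OF pred[OF this] vW[OF that]] vG(2) show False by blast
  qed
  have preds: "predecessors E G w \<subseteq> insert v U" if "w \<in> insert v U \<union> (set Q \<union> W)" for w
  proof (cases "w \<in> W")
    case False
    then have "w \<in> U \<union> set (v # Q)" using that by auto
    from pred[OF this] show ?thesis by blast
  qed (simp add: W_def)
  have complete: "w \<in> insert v U \<union> (set Q \<union> W) \<or> a G w > 4/3 * real \<rho>"
    if w: "w \<in> G" "predecessors E G w \<subseteq> insert v U" for w
  proof (cases "v \<in> predecessors E G w")
    case True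
    then show ?thesis using w by (auto simp: W_def predecessors_def)
  next
    case False
    then have "predecessors E G w \<subseteq> U" using w by blast
    moreover have "\<forall>w \<in> G. predecessors E G w \<subseteq> U \<longrightarrow> w \<in> U \<union> set (v # Q) \<or> a G w > 4/3 * real \<rho>"
      using inv unfolding small_subgraph_inv_def prod.case by (elim conjE)
    ultimately have "w \<in> U \<union> set (v # Q) \<or> a G w > 4/3 * real \<rho>" using w(1) by blast
    then show ?thesis by auto
  qed
  have "U \<subseteq> G" "set (v # Q) \<subseteq> G" "\<forall>w \<in> U. a G w \<le> 4/3 * real \<rho>" "distinct (v # Q)"
    using inv unfolding small_subgraph_inv_def prod.case by - ((elim conjE, assumption)+)
  then have 1: "insert v U \<subseteq> G" "set Q \<union> W \<subseteq> G" "\<forall>w \<in> insert v U. a G w \<le> 4/3 * real \<rho>" "distinct Q"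
    using le by (auto simp: W_def)
  have "w \<notin> insert v U \<union> set Q" if "w \<in> W" for w using new[OF that] by simp
  then have 2: "set Q \<inter> W = {}" "(set Q \<union> W) \<inter> insert v U = {}" using vG by blast+
  then have dist: "distinct (Q @ list_of_set W)" using W 1(4) by simp
  have preds': "\<forall>w \<in> insert v U \<union> (set Q \<union> W). predecessors E G w \<subseteq> insert v U"
    by (rule ballI) (rule preds)
  have complete': "\<forall>w \<in> G. predecessors E G w \<subseteq> insert v U \<longrightarrow>
      w \<in> insert v U \<union> (set Q \<union> W) \<or> a G w > 4/3 * real \<rho>"
    by (rule ballI, rule impI, rule complete)
  show ?thesis
    unfolding W_def[symmetric] small_subgraph_inv_def prod.case set_append W(2)
    by (intro conjI 1(1-3) 2(2) dist preds' complete')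
qed

lemma small_subgraph_inv_reject:
  assumes "small_subgraph_inv E a \<rho> G (v # Q, U)" "\<not> a G v \<le> 4/3 * real \<rho>"
  shows "small_subgraph_inv E a \<rho> G (Q, U)"
proof -
  have "\<forall>w \<in> G. predecessors E G w \<subseteq> U \<longrightarrow> w \<in> U \<union> set Q \<or> a G w > 4/3 * real \<rho>"
  proof (intro ballI impI)
    fix w assume w: "w \<in> G" "predecessors E G w \<subseteq> U"
    moreover have "\<forall>w \<in> G. predecessors E G w \<subseteq> U \<longrightarrow> w \<in> U \<union> set (v # Q) \<or> a G w > 4/3 * real \<rho>"
      using assms(1) unfolding small_subgraph_inv_def prod.case by (elim conjE)
    ultimately have "w \<in> U \<union> set (v # Q) \<or> a G w > 4/3 * real \<rho>" by blast
    then show "w \<in> U \<union> set Q \<or> a G w > 4/3 * real \<rho>" using assms(2) by (cases "w = v") auto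
  qed
  with assms(1) show ?thesis by (simp add: small_subgraph_inv_def)
qed

lemma small_subgraph_spec:
  fixes a :: "'v set \<Rightarrow> 'v \<Rightarrow> real" and \<rho> :: nat
  assumes "finite G" "acyclic E"
  defines "U \<equiv> small_subgraph E a \<rho> G"
  shows "U \<subseteq> G" "\<And>v. v \<in> U \<Longrightarrow> a G v \<le> 4/3 * real \<rho>"
    and "\<And>v. v \<in> U \<Longrightarrow> predecessors E G v \<subseteq> U"
    and "\<And>v. v \<in> G \<Longrightarrow> predecessors E G v \<subseteq> U \<Longrightarrow> v \<notin> U \<Longrightarrow> a G v > 4/3 * real \<rho>"
proof -
  define body where "body = (\<lambda>(Q, U).
          let v = hd Q; U' = insert v U in
          if a G v \<le> 4/3 * real \<rho>
          then (tl Q @ list_of_set {w \<in> G. (v, w) \<in> E \<and> predecessors E G w \<subseteq> U'}, U')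
          else (tl Q, U))"
  let ?init = "(list_of_set {v \<in> G. predecessors E G v = {}}, {})"
  let ?cond = "\<lambda>(Q :: 'v list, U :: 'v set). Q \<noteq> []"
  \<comment> \<open>Acceptance enlarges \<open>U\<close> but may lengthen the queue; rejection keeps
    \<open>U\<close> and shortens the queue.\<close>
  let ?R = "inv_image (less_than <*lex*> less_than) (\<lambda>(Q :: 'v list, U). (card (G - U), length Q))"
  have step: "small_subgraph_inv E a \<rho> G (body s) \<and> (body s, s) \<in> ?R"
    if inv: "small_subgraph_inv E a \<rho> G s" and ne: "?cond s" for s
  proof -
    obtain Q' U where s: "s = (Q', U)" by (cases s)
    with ne obtain v Q where Q: "Q' = v # Q" by (cases Q') auto
    show ?thesis
    proof (cases "a G v \<le> 4/3 * real \<rho>")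
      case True
      have b: "body s = (Q @ list_of_set {w \<in> G. (v, w) \<in> E \<and> predecessors E G w \<subseteq> insert v U}, insert v U)"
        using True by (simp add: body_def s Q Let_def)
      have "v \<in> G - U" using inv by (auto simp: s Q small_subgraph_inv_def)
      then have "G - insert v U \<subset> G - U" by blast
      then have "card (G - insert v U) < card (G - U)" using assms(1) by (intro psubset_card_mono) auto
      then show ?thesis using small_subgraph_inv_accept[OF inv[unfolded s Q] True assms(1,2)] unfolding b unfolding s Q by simp
    next
      case False
      then have b: "body s = (Q, U)" by (simp add: body_def s Q)
      show ?thesis using small_subgraph_inv_reject[OF inv[unfolded s Q] False] unfolding b unfolding s Q by simp
    qed
  qed
  have "set (list_of_set {v \<in> G. predecessors E G v = {}}) = {v \<in> G. predecessors E G v = {}}"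
    "distinct (list_of_set {v \<in> G. predecessors E G v = {}})"
    using list_of_set_spec[of "{v \<in> G. predecessors E G v = {}}"] assms(1) by auto
  then have "small_subgraph_inv E a \<rho> G ?init" by (auto simp: small_subgraph_inv_def)
  then have "small_subgraph_inv E a \<rho> G ([], snd (while ?cond body ?init))"
  proof (rule while_rule[where P = "small_subgraph_inv E a \<rho> G" and r = ?R])
    fix s assume "small_subgraph_inv E a \<rho> G s" "\<not> ?cond s"
    then show "small_subgraph_inv E a \<rho> G ([], snd s)" by (cases s) simp
  next
    fix s assume s: "small_subgraph_inv E a \<rho> G s" "?cond s"
    show "small_subgraph_inv E a \<rho> G (body s)" by (rule step[OF s, THEN conjunct1])
    show "(body s, s) \<in> ?R" by (rule step[OF s, THEN conjunct2])
  qed (intro wf_inv_image wf_lex_prod wf_less_than)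
  moreover have "U = snd (while ?cond body ?init)" by (simp add: U_def small_subgraph_def body_def)
  ultimately have fin: "small_subgraph_inv E a \<rho> G ([], U)" by simp
  show "U \<subseteq> G" "\<And>v. v \<in> U \<Longrightarrow> a G v \<le> 4/3 * real \<rho>" "\<And>v. v \<in> U \<Longrightarrow> predecessors E G v \<subseteq> U"
    "\<And>v. v \<in> G \<Longrightarrow> predecessors E G v \<subseteq> U \<Longrightarrow> v \<notin> U \<Longrightarrow> a G v > 4/3 * real \<rho>"
    using fin by (auto simp: small_subgraph_inv_def)
qed

text \<open>The vertex \<open>v\<close> may be left out because of an ancestor and not because of
  its own estimate. A minimal left-out ancestor \<open>u\<close> has all its predecessors accepted,
  so its own estimate exceeds \<open>4/3 * \<rho>\<close> and its true count exceeds \<rho>; the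
  ancestors of \<open>u\<close> are also ancestors of \<open>v\<close>.\<close>

lemma small_subgraph_rest:
  assumes "dag V E" "G \<subseteq> V" "estimates V E a e" "v \<in> G - small_subgraph E a \<rho> G"
  shows "card (ancestors E G v) > \<rho>"
proof -
  have fV: "finite V" and acyc: "acyclic E" using assms(1) by (auto simp: dag_def)
  have fG: "finite G" using fV assms(2) by (rule finite_subset[rotated])
  let ?X = "ancestors E G v - small_subgraph E a \<rho> G"
  have "wf (E \<inter> G \<times> G)" using fG acyclic_subset[OF acyc]
    by (intro finite_acyclic_wf) auto
  moreover have "v \<in> ?X" using assms(4) self_in_ancestors by auto
  ultimately obtain u where u: "u \<in> ?X" "\<forall>w. (w, u) \<in> E \<inter> G \<times> G \<longrightarrow> w \<notin> ?X"
    by (rule wfE_min) blast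
  have uG: "u \<in> G" using u(1) ancestors_subset[of E G v] by blast
  have "w \<in> small_subgraph E a \<rho> G" if "w \<in> predecessors E G u" for w
  proof -
    have w: "w \<in> G" "(w, u) \<in> E" using that by (auto simp: predecessors_def)
    then have "w \<in> ancestors E G v" using predecessor_in_ancestors[of w u E G v] u(1) by blast
    then show ?thesis using u(2) w uG by blast
  qed
  then have "a G u > 4/3 * real \<rho>"
    using small_subgraph_spec(4)[OF fG acyc uG, of a \<rho>] u(1) by blast
  moreover have "\<bar>a G u - real (card (ancestors E G u))\<bar> \<le> 1/3 * real (card (ancestors E G u))"
    using assms(2,3) uG unfolding estimates_def by blast
  ultimately have "real \<rho> < real (card (ancestors E G u))" by linarith
  moreover have "ancestors E G u \<subseteq> ancestors E G v" using u(1) ancestors_trans[of _ E G u v] by blast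
  then have "card (ancestors E G u) \<le> card (ancestors E G v)"
    using finite_ancestors[OF fG] by (rule card_mono[rotated])
  ultimately show ?thesis by linarith
qed

text \<open>Progress of the outer loop: a source of \<open>G\<close> has no ancestor but itself, so
  it cannot be among the vertices left out, which have more than \<rho>.\<close>

lemma small_subgraph_nonempty:
  assumes "dag V E" "G \<subseteq> V" "estimates V E a e" "\<rho> \<ge> 1" "G \<noteq> {}"
  shows "small_subgraph E a \<rho> G \<noteq> {}"
proof
  assume empty: "small_subgraph E a \<rho> G = {}"
  have fV: "finite V" and acyc: "acyclic E" using assms(1) by (auto simp: dag_def)
  have fG: "finite G" using fV assms(2) by (rule finite_subset[rotated])
  have "wf (E \<inter> G \<times> G)" using fG acyclic_subset[OF acyc]
    by (intro finite_acyclic_wf) auto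
  moreover obtain x where "x \<in> G" using assms(5) by blast
  ultimately obtain m where m: "m \<in> G" "\<forall>w. (w, m) \<in> E \<inter> G \<times> G \<longrightarrow> w \<notin> G"
    by (rule wfE_min) blast
  have no_pred: "(w, m) \<notin> induced_edges E G" for w using m(2) by (auto simp: induced_edges_def)
  then have "ancestors E G m \<subseteq> {m}" by (auto simp: ancestors_def elim: rtranclE)
  then have "card (ancestors E G m) \<le> 1" using card_mono[of "{m}"] by simp
  moreover have "card (ancestors E G m) > \<rho>"
    using small_subgraph_rest[OF assms(1-3)] m(1) empty by blast
  ultimately show False using assms(4) by linarith
qed

section \<open>Lower bounds for arbitrary valid schedules\<close>

text \<open>
  If nothing in \<open>G\<close> can start before \<open>\<tau>\<close>, then a copy starting before \<open>\<tau> + \<rho>\<close> receives nothing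
  from \<open>G\<close> over the network, so all its ancestors in \<open>G\<close> run on the same machine.
\<close>

lemma start_time_increases:
  assumes valid: "valid_schedule V E M \<rho> S" and early: "\<And>w \<mu> t. w \<in> G \<Longrightarrow> (w, \<mu>, t) \<in> S \<Longrightarrow> \<tau> \<le> t"
    and vt: "(v, \<mu>, t) \<in> S" and big: "card (ancestors E G v) > \<rho>"
  shows "\<tau> + \<rho> \<le> t"
proof (rule ccontr)
  assume "\<not> \<tau> + \<rho> \<le> t"
  then have lt: "t < \<tau> + \<rho>" by simp
  have "\<exists>t'. (u, \<mu>, t') \<in> S \<and> t' \<le> t" if "(u, v) \<in> (induced_edges E G)\<^sup>*" for u
    using that
  proof (induction rule: converse_rtrancl_induct)
    case base
    then show ?case using vt by blast
  next
    case (step u w)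
    then obtain t' where t': "(w, \<mu>, t') \<in> S" "t' \<le> t" by blast
    have uw: "(u, w) \<in> E" "u \<in> G" using step.hyps(1) by (auto simp: induced_edges_def)
    from valid_scheduleD(5)[OF valid t'(1) uw(1)] show ?case
    proof
      assume "\<exists>t''. (u, \<mu>, t'') \<in> S \<and> t'' + 1 \<le> t'"
      then show ?thesis using t'(2) by (meson add_leD1 order_trans)
    next
      assume "\<exists>\<mu>' t''. \<mu>' \<noteq> \<mu> \<and> (u, \<mu>', t'') \<in> S \<and> t'' + 1 + \<rho> \<le> t'"
      then obtain \<mu>' t'' where "(u, \<mu>', t'') \<in> S" "t'' + 1 + \<rho> \<le> t'" by blast
      with early[OF uw(2) this(1)] t'(2) lt show ?thesis by linarith
    qed
  qed
  then have "\<forall>u \<in> ancestors E G v. \<exists>t'. (u, \<mu>, t') \<in> S \<and> t' \<le> t" by (simp add: ancestors_def)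
  then obtain f where f: "\<forall>u \<in> ancestors E G v. (u, \<mu>, f u) \<in> S \<and> f u \<le> t" by (rule bchoice[THEN exE])
  have "inj_on f (ancestors E G v)"
  proof (rule inj_onI)
    fix u w assume uw: "u \<in> ancestors E G v" "w \<in> ancestors E G v" "f u = f w"
    have "(u, \<mu>, f u) \<in> S" "(w, \<mu>, f u) \<in> S"
      using bspec[OF f uw(1)] bspec[OF f uw(2)] uw(3) by simp_all
    then show "u = w" by (rule valid_scheduleD(4)[OF valid])
  qed
  \<comment> \<open>The ancestors share one machine, so they occupy distinct slots of this interval,
    which has at most \<rho> of them.\<close>
  moreover have "f ` ancestors E G v \<subseteq> {\<tau>..t}"
    using f early ancestors_subset[of E G v] by fastforce
  ultimately have "card (ancestors E G v) \<le> card {\<tau>..t}" by (rule card_inj_on_le) simp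
  then show False using big lt by simp
qed

lemma start_before_makespan:
  assumes "finite S" "(v, \<mu>, t) \<in> S" shows "t + 1 \<le> makespan S"
  unfolding makespan_def using assms by (intro Max_ge) force+

text \<open>Duplication only adds copies, and each pair of a machine and a slot holds at most one
  copy.\<close>

lemma card_le_machine_slots:
  assumes "valid_schedule V E M \<rho> S" shows "card V \<le> M * makespan S"
proof -
  note valid = valid_scheduleD[OF assms]
  have "V \<subseteq> fst ` S"
  proof
    fix v assume "v \<in> V"
    from valid(3)[OF this] show "v \<in> fst ` S" by force
  qed
  then have "card V \<le> card S" using valid(1) by (meson card_image_le card_mono finite_imageI order_trans)
  also have "inj_on snd S"
  proof (rule inj_onI)
    fix x y assume "x \<in> S" "y \<in> S" "snd x = snd y"
    then show "x = y" using valid(4)[of "fst x" "fst (snd x)" "snd (snd x)" "fst y"]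
      by (cases x, cases y) auto
  qed
  then have "card S = card (snd ` S)" by (simp add: card_image)
  also have "snd ` S \<subseteq> {..<M} \<times> {..<makespan S}"
  proof
    fix y assume "y \<in> snd ` S"
    then obtain v \<mu> t where "(v, \<mu>, t) \<in> S" "y = (\<mu>, t)" by force
    then show "y \<in> {..<M} \<times> {..<makespan S}"
      using valid(2)[of v \<mu> t] start_before_makespan[OF valid(1), of v \<mu> t] by auto
  qed
  then have "card (snd ` S) \<le> card ({..<M} \<times> {..<makespan S})" by (intro card_mono) auto
  finally show ?thesis by (simp add: card_cartesian_product)
qed

section \<open>The sequence of small subgraphs\<close>

text \<open>\<open>D\<close> collects the jobs of the earlier subgraphs. The clauses are the
  preconditions of \<open>schedule_small_subgraph_spec\<close>, arranged along the recursion of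
  \<open>schedule_subgraphs\<close>.\<close>

primrec layering :: "'v set \<Rightarrow> ('v \<times> 'v) set \<Rightarrow> nat \<Rightarrow> 'v set \<Rightarrow> 'v set list \<Rightarrow> bool" where
  "layering V E \<rho> D [] \<longleftrightarrow> True"
| "layering V E \<rho> D (H # Hs) \<longleftrightarrow>
     H \<subseteq> V \<and> (\<forall>v \<in> H. \<forall>u. (u, v) \<in> E \<longrightarrow> u \<in> D \<union> H) \<and>
     (\<forall>v \<in> H. card (ancestors E H v) \<le> 2 * \<rho>) \<and> layering V E \<rho> (D \<union> H) Hs"

lemma layering_append:
  "layering V E \<rho> D (Hs @ Hs') \<longleftrightarrow>
     layering V E \<rho> D Hs \<and> layering V E \<rho> (D \<union> \<Union>(set Hs)) Hs'"
  by (induction Hs arbitrary: D) (auto simp: Un_assoc)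

text \<open>The lower bounds speak of every valid schedule, so that an optimal one can be inserted
  at the end. The start times of the jobs left in \<open>G\<close> carry the induction. The makespan
  bound allows an extra \<rho> because the last subgraph may empty \<open>G\<close>, after which no
  start time pays for it.\<close>

definition small_subgraphs_inv ::
  "'v set \<Rightarrow> ('v \<times> 'v) set \<Rightarrow> nat \<Rightarrow> nat \<Rightarrow> 'v set \<times> 'v set list \<Rightarrow> bool" where
  "small_subgraphs_inv V E M \<rho> = (\<lambda>(G, Hs).
     G \<subseteq> V \<and> \<Union>(set Hs) = V - G \<and> layering V E \<rho> {} Hs \<and>
     (\<Sum>H\<leftarrow>Hs. card H) + card G = card V \<and>
     (\<forall>S. valid_schedule V E M \<rho> S \<longrightarrow>
        length Hs * \<rho> \<le> makespan S + \<rho> \<and> (\<forall>v \<mu> t. v \<in> G \<longrightarrow> (v, \<mu>, t) \<in> S \<longrightarrow> length Hs * \<rho> \<le> t)))"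

lemma small_subgraphs_inv_step:
  assumes "dag V E" "estimates V E a e" "\<rho> \<ge> 1"
    and inv: "small_subgraphs_inv V E M \<rho> (G, Hs)" and "G \<noteq> {}"
  shows "small_subgraphs_inv V E M \<rho> (G - small_subgraph E a \<rho> G, Hs @ [small_subgraph E a \<rho> G])"
proof -
  let ?H = "small_subgraph E a \<rho> G"
  have fV: "finite V" and acyc: "acyclic E" and EV: "E \<subseteq> V \<times> V" using assms(1) by (auto simp: dag_def)
  have GV: "G \<subseteq> V" and un: "\<Union>(set Hs) = V - G" and lay: "layering V E \<rho> {} Hs"
    and cards: "(\<Sum>H\<leftarrow>Hs. card H) + card G = card V"
    using inv by (auto simp: small_subgraphs_inv_def)
  have lower: "length Hs * \<rho> \<le> t"
    if "valid_schedule V E M \<rho> S" "v \<in> G" "(v, \<mu>, t) \<in> S" for S v \<mu> t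
    using inv that unfolding small_subgraphs_inv_def prod.case by blast
  have fG: "finite G" using fV GV by (rule finite_subset[rotated])
  note small = small_subgraph_spec[OF fG acyc, where a = a and \<rho> = \<rho>]
  have small_ancestors: "card (ancestors E ?H v) \<le> 2 * \<rho>" if "v \<in> ?H" for v
  proof -
    have "v \<in> V" using that small(1) GV by blast
    then have "\<bar>a G v - real (card (ancestors E G v))\<bar> \<le> 1/3 * real (card (ancestors E G v))"
      using assms(2) GV unfolding estimates_def by blast
    \<comment> \<open>The true count is at most 3/2 of the estimate, and 3/2 times 4/3 is 2.\<close>
    with small(2)[OF that] have "real (card (ancestors E G v)) \<le> 2 * real \<rho>" by linarith
    moreover have "card (ancestors E ?H v) \<le> card (ancestors E G v)"
      using finite_ancestors[OF fG] ancestors_mono[OF small(1)] by (rule card_mono)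
    ultimately show ?thesis by linarith
  qed
  have preds: "u \<in> \<Union>(set Hs) \<union> ?H" if "v \<in> ?H" "(u, v) \<in> E" for u v
  proof -
    have "u \<in> V" using that(2) EV by blast
    moreover have "u \<in> ?H" if "u \<in> G"
      using small(3)[OF \<open>v \<in> ?H\<close>] that \<open>(u, v) \<in> E\<close> by (auto simp: predecessors_def)
    ultimately show ?thesis unfolding un by blast
  qed
  have HV: "?H \<subseteq> V" using small(1) GV by (rule subset_trans)
  have lay': "layering V E \<rho> {} (Hs @ [?H])"
    unfolding layering_append layering.simps Un_empty_left
    by (intro conjI ballI allI impI lay HV small_ancestors preds TrueI)
  have "card (G - ?H) = card G - card ?H" "card ?H \<le> card G"
    using small(1) fG by (auto intro: card_Diff_subset card_mono finite_subset)
  then have cards': "(\<Sum>H\<leftarrow>Hs @ [?H]. card H) + card (G - ?H) = card V" using cards by simp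
  have bounds: "length (Hs @ [?H]) * \<rho> \<le> makespan S + \<rho>"
    "\<forall>v \<mu> t. v \<in> G - ?H \<longrightarrow> (v, \<mu>, t) \<in> S \<longrightarrow> length (Hs @ [?H]) * \<rho> \<le> t"
    if S: "valid_schedule V E M \<rho> S" for S
  proof -
    obtain w where w: "w \<in> G" using assms(5) by blast
    then have "w \<in> V" using GV by blast
    from valid_scheduleD(3)[OF S this] obtain \<mu> t where c: "(w, \<mu>, t) \<in> S" by blast
    \<comment> \<open>Before the step \<open>G\<close> still holds the job \<open>w\<close>, whose
      start time pays for the earlier subgraphs; the additive \<rho> pays for the new one.\<close>
    have "length Hs * \<rho> \<le> makespan S"
      using lower[OF S w c] start_before_makespan[OF valid_scheduleD(1)[OF S] c] by linarith
    then show "length (Hs @ [?H]) * \<rho> \<le> makespan S + \<rho>" by simp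
    show "\<forall>v \<mu> t. v \<in> G - ?H \<longrightarrow> (v, \<mu>, t) \<in> S \<longrightarrow> length (Hs @ [?H]) * \<rho> \<le> t"
    proof (intro allI impI)
      fix v \<mu> t assume v: "v \<in> G - ?H" "(v, \<mu>, t) \<in> S"
      have "length Hs * \<rho> + \<rho> \<le> t"
        using start_time_increases[OF S lower[OF S] v(2) small_subgraph_rest[OF assms(1) GV assms(2) v(1)]] .
      then show "length (Hs @ [?H]) * \<rho> \<le> t" by simp
    qed
  qed
  have "\<forall>S. valid_schedule V E M \<rho> S \<longrightarrow> length (Hs @ [?H]) * \<rho> \<le> makespan S + \<rho> \<and>
      (\<forall>v \<mu> t. v \<in> G - ?H \<longrightarrow> (v, \<mu>, t) \<in> S \<longrightarrow> length (Hs @ [?H]) * \<rho> \<le> t)"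
    by (rule allI, rule impI, rule conjI[OF bounds])
  moreover have "G - ?H \<subseteq> V" "\<Union>(set (Hs @ [?H])) = V - (G - ?H)" using GV un small(1) by auto
  ultimately show ?thesis using lay' cards' unfolding small_subgraphs_inv_def prod.case
    by (intro conjI)
qed

lemma small_subgraphs_spec:
  fixes a :: "'v set \<Rightarrow> 'v \<Rightarrow> real"
  assumes "dag V E" "estimates V E a e" "\<rho> \<ge> 1"
  defines "Hs \<equiv> small_subgraphs E a \<rho> V"
  shows "\<Union>(set Hs) = V" "layering V E \<rho> {} Hs" "(\<Sum>H\<leftarrow>Hs. card H) = card V"
    and "\<And>S. valid_schedule V E M \<rho> S \<Longrightarrow> length Hs * \<rho> \<le> makespan S + \<rho>"
proof -
  define body where "body = (\<lambda>(G, Hs). let H = small_subgraph E a \<rho> G in (G - H, Hs @ [H]))"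
  let ?cond = "\<lambda>(G :: 'v set, Hs :: 'v set list). G \<noteq> {}"
  have fV: "finite V" and acyc: "acyclic E" using assms(1) by (auto simp: dag_def)
  have step: "small_subgraphs_inv V E M \<rho> (body s) \<and> (body s, s) \<in> Wellfounded.measure (\<lambda>(G, Hs). card G)"
    if inv: "small_subgraphs_inv V E M \<rho> s" and ne: "?cond s" for s
  proof -
    obtain G Hs where s: "s = (G, Hs)" by (cases s)
    let ?H = "small_subgraph E a \<rho> G"
    have b: "body s = (G - ?H, Hs @ [?H])" by (simp add: body_def s Let_def)
    have "G \<noteq> {}" and GV: "G \<subseteq> V" using inv ne by (auto simp: s small_subgraphs_inv_def)
    have fG: "finite G" using fV GV by (rule finite_subset[rotated])
    have "?H \<noteq> {}" "?H \<subseteq> G"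
      using small_subgraph_nonempty[OF assms(1) GV assms(2,3) \<open>G \<noteq> {}\<close>] small_subgraph_spec(1)[OF fG acyc]
      by auto
    then have "G - ?H \<subset> G" by blast
    then have "card (G - ?H) < card G" using fG by (rule psubset_card_mono[rotated])
    then show ?thesis
      using small_subgraphs_inv_step[OF assms(1-3) inv[unfolded s] \<open>G \<noteq> {}\<close>] unfolding b unfolding s by simp
  qed
  have "small_subgraphs_inv V E M \<rho> (V, [])" by (simp add: small_subgraphs_inv_def)
  then have "small_subgraphs_inv V E M \<rho> ({}, snd (while ?cond body (V, [])))"
  proof (rule while_rule[where P = "small_subgraphs_inv V E M \<rho>" and r = "Wellfounded.measure (\<lambda>(G, Hs). card G)"])
    fix s assume "small_subgraphs_inv V E M \<rho> s" "\<not> ?cond s"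
    then show "small_subgraphs_inv V E M \<rho> ({}, snd s)" by (cases s) simp
  next
    fix s assume s: "small_subgraphs_inv V E M \<rho> s" "?cond s"
    show "small_subgraphs_inv V E M \<rho> (body s)" by (rule step[OF s, THEN conjunct1])
    show "(body s, s) \<in> Wellfounded.measure (\<lambda>(G, Hs). card G)" by (rule step[OF s, THEN conjunct2])
  qed (rule wf_measure)
  moreover have "Hs = snd (while ?cond body (V, []))" by (simp add: Hs_def small_subgraphs_def body_def)
  ultimately have "small_subgraphs_inv V E M \<rho> ({}, Hs)" by simp
  then show "\<Union>(set Hs) = V" "layering V E \<rho> {} Hs" "(\<Sum>H\<leftarrow>Hs. card H) = card V"
    "\<And>S. valid_schedule V E M \<rho> S \<Longrightarrow> length Hs * \<rho> \<le> makespan S + \<rho>"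
    by (simp_all add: small_subgraphs_inv_def)
qed

section \<open>The length of the schedule\<close>

lemma within_batches_initial:
  assumes "finite H" "\<forall>v \<in> H. card (ancestors E H v) \<le> 2 * \<rho>" "j \<ge> 1" "\<gamma> > 0"
    and "(4 * \<gamma>) ^ (j - 1) * (8 * real \<rho> ^ 3) < 1"
  shows "within_batches E \<gamma> j H"
  unfolding within_batches_def
proof (intro conjI ballI impI)
  fix v assume "v \<in> H"
  then have a: "card (ancestors E H v) \<le> 2 * \<rho>" using assms(2) by blast
  have "card (ancestor_edges E H v) \<le> (2 * \<rho>)\<^sup>2"
    using card_ancestor_edges_le[OF assms(1), of E v] power_mono[OF a, of 2] by linarith
  from mult_le_mono[OF a this]
  have "card (ancestors E H v) * card (ancestor_edges E H v) \<le> 8 * \<rho> ^ 3"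
    by (simp add: power2_eq_square power3_eq_cube)
  then have "real (card (ancestors E H v) * card (ancestor_edges E H v)) \<le> real (8 * \<rho> ^ 3)"
    by (rule of_nat_mono)
  then have "(4 * \<gamma>) ^ (j - 1) * (real (card (ancestors E H v)) * real (card (ancestor_edges E H v)))
      \<le> (4 * \<gamma>) ^ (j - 1) * (8 * real \<rho> ^ 3)"
    using assms(4) by (intro mult_left_mono) simp_all
  with assms(5) show "(4 * \<gamma>) ^ (j - 1) * (real (card (ancestors E H v)) * real (card (ancestor_edges E H v))) < 1"
    by linarith
qed (use assms(3) in simp)

text \<open>One budget \<open>j\<close> serves all subgraphs, because the initial potential is at
  most \<open>8 * \<rho> ^ 3\<close> in each of them.\<close>

lemma schedule_subgraphs_spec:
  assumes "dag V E" "M \<ge> 1" "\<rho> \<ge> 1" "N \<ge> 1" "estimates V E a e" "0 < \<gamma>" "4 * \<gamma> < 1"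
    and j: "j \<ge> 1" "(4 * \<gamma>) ^ (j - 1) * (8 * real \<rho> ^ 3) < 1"
    and "layering V E \<rho> D Hs" "ready D E M \<rho> T S"
  shows "lossless_spmf (schedule_subgraphs E a e M \<rho> N \<gamma> Hs T S) \<and>
    (\<forall>S' \<in> set_spmf (schedule_subgraphs E a e M \<rho> N \<gamma> Hs T S).
       \<exists>T'. ready (D \<union> \<Union>(set Hs)) E M \<rho> T' S' \<and>
       real T' \<le> real T + real (\<Sum>H\<leftarrow>Hs. card H) / (\<gamma> * real M) + 3 * real \<rho> * real j * real (length Hs))"
  using assms(10,11)
proof (induction Hs arbitrary: D T S)
  case Nil
  then show ?case by auto
next
  case (Cons H Hs)
  have fV: "finite V" using assms(1) by (simp add: dag_def)
  have HV: "H \<subseteq> V" and preds: "\<forall>v \<in> H. \<forall>u. (u, v) \<in> E \<longrightarrow> u \<in> D \<union> H"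
    and small: "\<forall>v \<in> H. card (ancestors E H v) \<le> 2 * \<rho>" and lay: "layering V E \<rho> (D \<union> H) Hs"
    using Cons.prems(1) by simp_all
  have fH: "finite H" using fV HV by (rule finite_subset[rotated])
  note p = schedule_small_subgraph_spec[OF assms(1-7) HV within_batches_initial[OF fH small j(1) assms(6) j(2)]
      small preds Cons.prems(2)]
  show ?case unfolding schedule_subgraphs.simps
  proof (rule bind_spmf_spec)
    show "lossless_spmf (schedule_small_subgraph E a e M \<rho> N \<gamma> H T S)" by (rule p[THEN conjunct1])
    fix x assume x: "x \<in> set_spmf (schedule_small_subgraph E a e M \<rho> N \<gamma> H T S)"
    obtain T1 S1 where x1: "x = (T1, S1)" by (cases x)
    from bspec[OF p[THEN conjunct2] x] have ready: "ready (D \<union> H) E M \<rho> T1 S1"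
      and T1: "real T1 \<le> real T + real (card H) / (\<gamma> * real M) + 3 * real \<rho> * real j"
      unfolding x1 by simp_all
    note IH = Cons.IH[OF lay ready]
    have un: "D \<union> H \<union> \<Union>(set Hs) = D \<union> \<Union>(set (H # Hs))" by auto
    have le: "real T1 + real (\<Sum>H\<leftarrow>Hs. card H) / (\<gamma> * real M) + 3 * real \<rho> * real j * real (length Hs)
      \<le> real T + real (\<Sum>H\<leftarrow>H # Hs. card H) / (\<gamma> * real M) + 3 * real \<rho> * real j * real (length (H # Hs))"
      using T1 by (simp add: add_divide_distrib algebra_simps)
    have "\<exists>T'. ready (D \<union> \<Union>(set (H # Hs))) E M \<rho> T' S' \<and> real T' \<le> real T
        + real (\<Sum>H\<leftarrow>H # Hs. card H) / (\<gamma> * real M) + 3 * real \<rho> * real j * real (length (H # Hs))"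
      if S': "S' \<in> set_spmf (schedule_subgraphs E a e M \<rho> N \<gamma> Hs T1 S1)" for S'
    proof -
      from bspec[OF IH[THEN conjunct2] S'] obtain T' where T': "ready (D \<union> H \<union> \<Union>(set Hs)) E M \<rho> T' S'"
        "real T' \<le> real T1 + real (\<Sum>H\<leftarrow>Hs. card H) / (\<gamma> * real M) + 3 * real \<rho> * real j * real (length Hs)"
        by (elim exE conjE)
      show ?thesis
        by (rule exI[of _ T'], rule conjI[OF T'(1)[unfolded un] order_trans[OF T'(2) le]])
    qed
    with IH[THEN conjunct1] show "lossless_spmf (case x of (T', S') \<Rightarrow> schedule_subgraphs E a e M \<rho> N \<gamma> Hs T' S') \<and>
      (\<forall>S' \<in> set_spmf (case x of (T', S') \<Rightarrow> schedule_subgraphs E a e M \<rho> N \<gamma> Hs T' S').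
       \<exists>T'. ready (D \<union> \<Union>(set (H # Hs))) E M \<rho> T' S' \<and> real T' \<le> real T
        + real (\<Sum>H\<leftarrow>H # Hs. card H) / (\<gamma> * real M) + 3 * real \<rho> * real j * real (length (H # Hs)))"
      unfolding x1 prod.case by (intro conjI ballI)
  qed
qed

lemma makespan_le_if_ready:
  assumes "ready D E M \<rho> T S" shows "makespan S \<le> T"
proof -
  have "finite S" using assms valid_scheduleD(1) by (auto simp: ready_def)
  moreover have "t + 1 \<le> T" if "(v, \<mu>, t) \<in> S" for v \<mu> t using assms that by (auto simp: ready_def)
  ultimately show ?thesis unfolding makespan_def by (subst Max_le_iff) auto
qed

lemma schedule_general_graph_spec:
  assumes "dag V E" "M \<ge> 1" "\<rho> \<ge> 1" "N \<ge> 1" "estimates V E a e" "0 < \<gamma>" "4 * \<gamma> < 1"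
    and j: "j \<ge> 1" "(4 * \<gamma>) ^ (j - 1) * (8 * real \<rho> ^ 3) < 1"
  shows "lossless_spmf (schedule_general_graph V E a e M \<rho> N \<gamma>) \<and>
    (\<forall>S \<in> set_spmf (schedule_general_graph V E a e M \<rho> N \<gamma>). valid_schedule V E M \<rho> S \<and>
       real (makespan S) \<le> real (OPT V E M \<rho>) / \<gamma> + 3 * real j * (real (OPT V E M \<rho>) + real \<rho>))"
proof -
  let ?Hs = "small_subgraphs E a \<rho> V"
  note Hs = small_subgraphs_spec[OF assms(1,5,3)]
  have "ready {} E M \<rho> 0 {}" by (simp add: ready_def valid_schedule_def)
  note sched = schedule_subgraphs_spec[OF assms(1-9) Hs(2) this, folded schedule_general_graph_def]
  have "valid_schedule V E M \<rho> S \<and>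
       real (makespan S) \<le> real (OPT V E M \<rho>) / \<gamma> + 3 * real j * (real (OPT V E M \<rho>) + real \<rho>)"
    if S: "S \<in> set_spmf (schedule_general_graph V E a e M \<rho> N \<gamma>)" for S
  proof -
    from bspec[OF sched[THEN conjunct2] S] obtain T where ready: "ready V E M \<rho> T S"
      and T: "real T \<le> real (card V) / (\<gamma> * real M) + 3 * real \<rho> * real j * real (length ?Hs)"
      unfolding Hs(1,3) by auto
    have valid: "valid_schedule V E M \<rho> S" using ready by (simp add: ready_def)
    \<comment> \<open>The schedule just produced shows that the \<open>LEAST\<close> in
      \<open>OPT\<close> ranges over a nonempty set, so \<open>OPT\<close> is attained.\<close>
    then have "\<exists>T S. valid_schedule V E M \<rho> S \<and> makespan S = T" by blast
    then have "\<exists>S. valid_schedule V E M \<rho> S \<and> makespan S = OPT V E M \<rho>"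
      unfolding OPT_def by (rule LeastI_ex)
    then obtain S0 where S0: "valid_schedule V E M \<rho> S0" "makespan S0 = OPT V E M \<rho>" by blast
    have "card V \<le> M * OPT V E M \<rho>" using card_le_machine_slots[OF S0(1)] S0(2) by simp
    then have "real (card V) \<le> real (M * OPT V E M \<rho>)" by (rule of_nat_mono)
    then have "real (card V) / (\<gamma> * real M) \<le> real (M * OPT V E M \<rho>) / (\<gamma> * real M)"
      using assms(6) by (intro divide_right_mono) auto
    also have "\<dots> = real (OPT V E M \<rho>) / \<gamma>" using assms(2) by simp
    finally have 1: "real (card V) / (\<gamma> * real M) \<le> real (OPT V E M \<rho>) / \<gamma>" .
    have "length ?Hs * \<rho> \<le> OPT V E M \<rho> + \<rho>" using Hs(4)[OF S0(1)] S0(2) by simp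
    then have "real (length ?Hs * \<rho>) \<le> real (OPT V E M \<rho> + \<rho>)" by (rule of_nat_mono)
    then have "3 * real j * (real \<rho> * real (length ?Hs)) \<le> 3 * real j * (real (OPT V E M \<rho>) + real \<rho>)"
      by (intro mult_left_mono) (simp_all add: mult.commute)
    moreover have "real (makespan S) \<le> real T" using makespan_le_if_ready[OF ready] by simp
    ultimately show ?thesis using valid T 1 by (simp add: mult_ac)
  qed
  with sched[THEN conjunct1] show ?thesis by blast
qed

section \<open>Numerical estimates for large \<rho>\<close>

text \<open>This is twice \<open>ln y \<le> y - 1\<close> at \<open>y = sqrt x\<close>, weakened. It
  bounds \<open>1 / \<gamma> = sqrt (ln \<rho>)\<close> by a multiple of
  \<open>ln \<rho> / ln (ln \<rho>)\<close>.\<close>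

lemma ln_le_2_sqrt:
  assumes "x > 0" shows "ln x \<le> 2 * sqrt (x::real)"
  using ln_le_minus_one[of "sqrt x"] assms by (simp add: ln_sqrt)

text \<open>
  The threshold \<open>exp 256\<close> makes \<open>4\<gamma> = 4 / sqrt (ln \<rho>) \<le> (ln \<rho>) powr (-1/4)\<close>, so that
  \<open>16 ln \<rho> / ln (ln \<rho>)\<close> batches shrink any product by \<open>\<rho>\<^sup>4\<close>.
\<close>

lemma batch_number:
  fixes \<rho> :: nat
  assumes "real \<rho> \<ge> exp 256"
  defines "L \<equiv> ln (real \<rho>) / ln (ln (real \<rho>))" and "\<gamma> \<equiv> 1 / sqrt (ln (real \<rho>))"
  shows "0 < \<gamma>" "4 * \<gamma> < 1" "1 / \<gamma> \<le> 2 * L"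
    and "\<exists>j \<ge> 1. (4 * \<gamma>) ^ (j - 1) * (8 * real \<rho> ^ 3) < 1 \<and> real j \<le> 18 * L"
proof -
  define x where "x = ln (real \<rho>)"
  have pos: "real \<rho> > 0" using assms(1) exp_gt_zero[of 256] by linarith
  then have x256: "x \<ge> 256" using assms(1) by (simp add: x_def ln_ge_iff)
  have lnx: "ln x > 0" using x256 by simp
  have s16: "sqrt x \<ge> 16" using x256 by (intro real_le_rsqrt) simp
  have g: "\<gamma> = 1 / sqrt x" by (simp add: \<gamma>_def x_def)
  from s16 have "sqrt x > 0" by linarith
  then show "0 < \<gamma>" "4 * \<gamma> < 1" using s16 by (simp_all add: g divide_less_eq)
  have L: "L = x / ln x" by (simp add: L_def x_def)
  have "sqrt x * ln x \<le> sqrt x * (2 * sqrt x)"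
    using ln_le_2_sqrt[of x] x256 by (intro mult_left_mono) auto
  also have "\<dots> = 2 * x" using x256 by (simp add: mult_ac)
  finally show "1 / \<gamma> \<le> 2 * L" using lnx by (simp add: g L field_simps)
  have "ln x \<le> x - 1" using x256 by (intro ln_le_minus_one) simp
  then have L1: "L \<ge> 1" using lnx x256 by (simp add: L)
  \<comment> \<open>Since \<open>16 * L * (ln x / 4) = 4 * x\<close>, this many factors
    \<open>4 * \<gamma>\<close> outweigh \<open>\<rho> ^ 4\<close>, one power more than the
    potential contains; the spare power absorbs the factor 8.\<close>
  define m where "m = nat \<lceil>16 * L\<rceil>"
  have m: "16 * L \<le> real m" "real m \<le> 16 * L + 1" using L1 by (auto simp: m_def)
  \<comment> \<open>The claim amounts to \<open>ln x \<ge> 4 * ln 4\<close>, that is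
    \<open>x \<ge> 256\<close>, the origin of the threshold.\<close>
  have q: "ln (4 * \<gamma>) \<le> - (ln x / 4)"
  proof -
    have "ln 256 \<le> ln x" using x256 by simp
    moreover have "ln (256::real) = 4 * ln 4" using ln_realpow[of "4::real" 4] by simp
    moreover have "ln (4 * \<gamma>) = ln 4 - ln x / 2" using x256 by (simp add: g ln_div ln_sqrt)
    ultimately show ?thesis by linarith
  qed
  have "(4 * \<gamma>) ^ m = exp (real m * ln (4 * \<gamma>))"
    using \<open>0 < \<gamma>\<close> by (simp add: exp_of_nat_mult)
  also have "\<dots> \<le> exp (- (4 * x))"
  proof -
    have "16 * L * (ln x / 4) = 4 * x" using lnx by (simp add: L)
    moreover have "16 * L * (ln x / 4) \<le> real m * (ln x / 4)" using m(1) lnx by (intro mult_right_mono) auto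
    moreover have "real m * ln (4 * \<gamma>) \<le> real m * (- (ln x / 4))" using q by (intro mult_left_mono) auto
    ultimately show ?thesis by simp
  qed
  also have "exp (- (4 * x)) = 1 / real \<rho> ^ 4"
  proof -
    have "exp (4 * x) = exp x ^ 4" using exp_of_nat_mult[of 4 x] by simp
    then show ?thesis using pos by (simp add: exp_minus x_def inverse_eq_divide)
  qed
  finally have "(4 * \<gamma>) ^ m * (8 * real \<rho> ^ 3) \<le> 1 / real \<rho> ^ 4 * (8 * real \<rho> ^ 3)"
    by (rule mult_right_mono) simp
  also have "\<dots> = 8 / real \<rho>" using pos by (simp add: field_simps power_eq_if)
  also have "\<dots> < 1" using assms(1) exp_ge_add_one_self[of 256] pos by simp
  finally have "(4 * \<gamma>) ^ (Suc m - 1) * (8 * real \<rho> ^ 3) < 1" by simp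
  \<comment> \<open>Rounding and the reserved last batch add at most 2, which
    \<open>L \<ge> 1\<close> turns into \<open>2 * L\<close>.\<close>
  moreover have "real (Suc m) \<le> 18 * L" using m(2) L1 by simp
  ultimately show "\<exists>j \<ge> 1. (4 * \<gamma>) ^ (j - 1) * (8 * real \<rho> ^ 3) < 1 \<and> real j \<le> 18 * L"
    by (intro exI[of _ "Suc m"]) auto
qed

theorem theorem22:
  shows "\<exists>(C::real) (\<rho>\<^sub>0::nat).
    \<forall>(V :: 'v set) E (M::nat) (\<rho>::nat) (N :: nat \<Rightarrow> nat) a e.
      dag V E \<and> M \<ge> 1 \<and> \<rho> > 1 \<and> \<rho> \<ge> \<rho>\<^sub>0 \<and>
      (\<forall>n. N n \<ge> 1) \<and> (\<lambda>n. real (N n)) \<in> \<Theta>(\<lambda>n. ln (real n)) \<and>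
      estimates V E a e
      \<longrightarrow>
      lossless_spmf (schedule_general_graph V E a e M \<rho> (N (card V)) (1 / sqrt (ln (real \<rho>)))) \<and>
      (\<forall>S \<in> set_spmf (schedule_general_graph V E a e M \<rho> (N (card V)) (1 / sqrt (ln (real \<rho>)))).
         valid_schedule V E M \<rho> S \<and>
         real (makespan S)
           \<le> C * (ln (real \<rho>) / ln (ln (real \<rho>))) * (real (OPT V E M \<rho>) + real \<rho>))"
\<comment> \<open>The witnesses stay schematic here. They become \<open>C = 56\<close>, which is 2
  for the volume term plus 3 * 18 for the batches, and the least natural number not below
  \<open>exp 256\<close>.\<close>
proof (intro exI allI impI)
  fix V :: "'v set" and E and M \<rho> :: nat and N :: "nat \<Rightarrow> nat" and a e
  assume asm: "dag V E \<and> M \<ge> 1 \<and> \<rho> > 1 \<and> \<rho> \<ge> nat \<lceil>exp (256 :: real)\<rceil> \<and>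
      (\<forall>n. N n \<ge> 1) \<and> (\<lambda>n. real (N n)) \<in> \<Theta>(\<lambda>n. ln (real n)) \<and> estimates V E a e"
  let ?L = "ln (real \<rho>) / ln (ln (real \<rho>))" and ?\<gamma> = "1 / sqrt (ln (real \<rho>))"
  have "real \<rho> \<ge> exp 256" using asm by linarith
  note batches = batch_number[OF this]
  obtain j where j: "j \<ge> 1" "(4 * ?\<gamma>) ^ (j - 1) * (8 * real \<rho> ^ 3) < 1" "real j \<le> 18 * ?L"
    using batches(4) by (elim exE conjE)
  have "dag V E" "M \<ge> 1" "\<rho> \<ge> 1" "N (card V) \<ge> 1" "estimates V E a e" using asm by auto
  note spec = schedule_general_graph_spec[OF this batches(1,2) j(1,2)]
  let ?O = "real (OPT V E M \<rho>)"
  have "?O / ?\<gamma> \<le> 2 * ?L * (?O + real \<rho>)"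
  proof -
    have "?O / ?\<gamma> = 1 / ?\<gamma> * ?O" by simp
    also have "\<dots> \<le> 2 * ?L * ?O" using batches(3) by (rule mult_right_mono) simp
    also have "\<dots> \<le> 2 * ?L * (?O + real \<rho>)"
      \<comment> \<open>Nonnegativity of \<open>?L\<close> is read off from \<open>1 \<le> j\<close>
        and \<open>j \<le> 18 * ?L\<close>.\<close>
      using j(1,3) by (intro mult_left_mono) linarith+
    finally show ?thesis .
  qed
  moreover have "3 * real j * (?O + real \<rho>) \<le> 54 * ?L * (?O + real \<rho>)"
    using j(3) by (intro mult_right_mono) linarith+
  ultimately have bound: "?O / ?\<gamma> + 3 * real j * (?O + real \<rho>) \<le> 56 * ?L * (?O + real \<rho>)"
    using distrib_right[of 2 54 "?L * (?O + real \<rho>)"] by (simp only: mult.assoc)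
  show "lossless_spmf (schedule_general_graph V E a e M \<rho> (N (card V)) ?\<gamma>) \<and>
      (\<forall>S \<in> set_spmf (schedule_general_graph V E a e M \<rho> (N (card V)) ?\<gamma>).
         valid_schedule V E M \<rho> S \<and> real (makespan S) \<le> 56 * ?L * (?O + real \<rho>))"
  proof (intro conjI ballI)
    fix S assume "S \<in> set_spmf (schedule_general_graph V E a e M \<rho> (N (card V)) ?\<gamma>)"
    note S = bspec[OF spec[THEN conjunct2] this]
    show "valid_schedule V E M \<rho> S" by (rule S[THEN conjunct1])
    show "real (makespan S) \<le> 56 * ?L * (?O + real \<rho>)" by (rule order_trans[OF S[THEN conjunct2] bound])
  qed (rule spec[THEN conjunct1])
qed

end
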